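(* Let $0<r<1$, and let $f_r(z)=\dfrac{\operatorname{Log}(1+rz)}{\operatorname{Log}(1+z)}$ for $z\in\mathbb{C}\setminus(-\infty,-1]$, with $f_r(0)=r$. Define $\sigma_r:(1,\infty)\to[0,\infty]$ by $$\sigma_r(t)=\begin{cases}\dfrac{-\log(1-rt)}{t\left(\log^2(t-1)+\pi^2\right)}, & 1<t<1/r,\\[2mm] \infty, & t=1/r,\\[1mm] \dfrac{\log\left((t-1)/(rt-1)\right)}{t\left(\log^2(t-1)+\pi^2\right)}, & 1/r<t.\end{cases}$$ Then the following hold. (1) $f_r$ (restricted to $(0,\infty)$) is a complete Bernstein function, and for all $z\in\mathbb{C}\setminus(-\infty,-1]$, $$f_r(z)=r+\int_1^\infty\frac{z}{z+t}\,\sigma_r(t)\,dt.$$ (2) On the interval $(-1,\infty)$ the function $f_r$ is strictly concave and strictly increasing from $0$ to $1$ (that is, $\lim_{x\to-1^+}f_r(x)=0$ and $\lim_{x\to\infty}f_r(x)=1$). (3) The function $1-f_r$ is a Stieltjes function, given for $z\in\mathbb{C}\setminus(-\infty,-1]$ by $$1-f_r(z)=\int_1^\infty\frac{t\,\sigma_r(t)}{z+t}\,dt.$$ (4) The function $f_r(z)/z$ is a Stieltjes function, given for $z\in\mathbb{C}\setminus(-\infty,0]$ by $$\frac{f_r(z)}{z}=\int_{[0,\infty)}\frac{d\mu_r(t)}{z+t},\qquad \mu_r=r\,\delta_0+1_{(1,\infty)}(t)\,\sigma_r(t)\,dt,$$ where $\delta_0$ is the Dirac measure at $0$. (5) $\sigma_r(t)\to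 0$ as $t\to 1^+$ and as $t\to\infty$. (6) $$\int_1^\infty\sigma_r(t)\,dt=1-r,\qquad \int_1^\infty\frac{\sigma_r(t)\,dt}{1+t^2}=\frac{\log 2\,\log(1+r^2)+\pi\arctan(r)}{\log^2(2)+\pi^2/4}-r.$$
   Context: $\operatorname{Log}$ is the principal branch of the logarithm on $\mathbb{C}\setminus(-\infty,0]$, $\operatorname{Log}(z)=\log|z|+i\operatorname{Arg}(z)$ with $\operatorname{Arg}(z)\in(-\pi,\pi)$; $\log$ is the real natural logarithm and $\log^2(u)=(\log u)^2$. The point $z=0$ is a removable singularity of the quotient defining $f_r$, with value $f_r(0)=r$, so $f_r$ is holomorphic on $\mathbb{C}\setminus(-\infty,-1]$. A function $m:(0,\infty)\to[0,\infty)$ is completely monotonic if it is $C^\infty$ and $(-1)^n m^{(n)}(s)\ge 0$ for all $s>0$, $n=0,1,2,\ldots$. A complete Bernstein function is a function $f:(0,\infty)\to[0,\infty)$ of the form $$f(x)=a+bx+\int_0^\infty (1-e^{-xs})\,m(s)\,ds,\quad x>0,$$ where $a,b\ge 0$ and $m:(0,\infty)\to[0,\infty)$ is completely monotonic with $\int_0^\infty \min(1,s)\,m(s)\,ds<\infty$. A Stieltjes function is a function $f:(0,\infty)\to[0,\infty)$ of the form $$f(x)=c+\int_{[0,\infty)}\frac{d\mu(t)}{x+t},\quad x>0,$$ where $c\ge 0$ and $\mu$ is a positive measure on $[0,\infty)$ such that the integral converges for every $x>0$. A Stieltjes function extends holomorphically to $\mathbb{C}\setminus(-\infty,0]$ by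 the same formula. A function holomorphic on a domain containing $(0,\infty)$ is called a complete Bernstein function or a Stieltjes function if its restriction to $(0,\infty)$ is one. *)

theory Defs
  imports "HOL-Complex_Analysis.Complex_Analysis" "HOL-Probability.Giry_Monad"
begin

definition slit_plane :: "real \<Rightarrow> complex set" where
  "slit_plane a = - (complex_of_real ` {..a})"

definition strictly_concave_on :: "'a::real_vector set \<Rightarrow> ('a \<Rightarrow> real) \<Rightarrow> bool" where
  "strictly_concave_on S f \<longleftrightarrow>
     convex S \<and>
     (\<forall>x\<in>S. \<forall>y\<in>S. \<forall>u. x \<noteq> y \<and> 0 < u \<and> u < 1 \<longrightarrow>
        f ((1 - u) *\<^sub>R x + u *\<^sub>R y) > (1 - u) * f x + u * f y)"

text \<open>
  In the following three definitions only the values of the functions on the open half-line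
  matter; in particular the iterated derivatives at \<open>s > 0\<close> depend only on the values
  of \<open>m\<close> near \<open>s\<close>.
\<close>

definition completely_monotonic :: "(real \<Rightarrow> real) \<Rightarrow> bool" where
  "completely_monotonic m \<longleftrightarrow>
     (\<forall>n. \<forall>s>0. (deriv ^^ n) m differentiable at s \<and> (-1) ^ n * (deriv ^^ n) m s \<ge> 0)"

definition complete_bernstein :: "(real \<Rightarrow> real) \<Rightarrow> bool" where
  "complete_bernstein f \<longleftrightarrow>
     (\<forall>x>0. 0 \<le> f x) \<and>
     (\<exists>a b m. 0 \<le> a \<and> 0 \<le> b \<and> completely_monotonic m \<and>
        set_integrable lborel {0<..} (\<lambda>s. min 1 s * m s) \<and>
        (\<forall>x>0. f x = a + b * x + (LINT s:{0<..}|lborel. (1 - exp (- (x * s))) * m s)))"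

definition stieltjes :: "(real \<Rightarrow> real) \<Rightarrow> bool" where
  "stieltjes f \<longleftrightarrow>
     (\<forall>x>0. 0 \<le> f x) \<and>
     (\<exists>c \<mu>. 0 \<le> c \<and> sets \<mu> = sets (restrict_space borel {0..}) \<and>
        (\<forall>x>0. integrable \<mu> (\<lambda>t. 1 / (x + t)) \<and>
               f x = c + (LINT t|\<mu>. 1 / (x + t))))"

definition complete_bernstein_on :: "complex set \<Rightarrow> (complex \<Rightarrow> complex) \<Rightarrow> bool" where
  "complete_bernstein_on D F \<longleftrightarrow>
     open D \<and> connected D \<and> complex_of_real ` {0<..} \<subseteq> D \<and> F holomorphic_on D \<and>
     (\<exists>g. complete_bernstein g \<and> (\<forall>x>0. F (complex_of_real x) = complex_of_real (g x)))"

definition stieltjes_on :: "complex set \<Rightarrow> (complex \<Rightarrow> complex) \<Rightarrow> bool" where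
  "stieltjes_on D F \<longleftrightarrow>
     open D \<and> connected D \<and> complex_of_real ` {0<..} \<subseteq> D \<and> F holomorphic_on D \<and>
     (\<exists>g. stieltjes g \<and> (\<forall>x>0. F (complex_of_real x) = complex_of_real (g x)))"

definition f_r :: "real \<Rightarrow> complex \<Rightarrow> complex" where
  "f_r r z = (if z = 0 then of_real r else Ln (1 + of_real r * z) / Ln (1 + z))"

text \<open>
  Only the values for \<open>t > 1\<close> are meaningful. There the coercion \<open>ennreal\<close> does not
  truncate, see \<open>sigma_r_nonneg\<close> below.
\<close>

definition sigma_r :: "real \<Rightarrow> real \<Rightarrow> ennreal" where
  "sigma_r r t =
     (if t < 1 / r then ennreal (- ln (1 - r * t) / (t * ((ln (t - 1))\<^sup>2 + pi\<^sup>2)))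
      else if t = 1 / r then \<infinity>
      else ennreal (ln ((t - 1) / (r * t - 1)) / (t * ((ln (t - 1))\<^sup>2 + pi\<^sup>2))))"

lemma sigma_r_nonneg:
  fixes r t :: real
  assumes "0 < r" "r < 1" "1 < t"
  shows "t < 1 / r \<Longrightarrow> 0 \<le> - ln (1 - r * t) / (t * ((ln (t - 1))\<^sup>2 + pi\<^sup>2))"
    and "1 / r < t \<Longrightarrow> 0 \<le> ln ((t - 1) / (r * t - 1)) / (t * ((ln (t - 1))\<^sup>2 + pi\<^sup>2))"
proof -
  assume "t < 1 / r"
  then have "0 < 1 - r * t" "1 - r * t < 1"
    using assms by (simp_all add: field_simps)
  then have "ln (1 - r * t) \<le> 0" by simp
  then show "0 \<le> - ln (1 - r * t) / (t * ((ln (t - 1))\<^sup>2 + pi\<^sup>2))"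
    using assms by (intro divide_nonneg_nonneg mult_nonneg_nonneg add_nonneg_nonneg) auto
next
  assume "1 / r < t"
  then have "0 < r * t - 1" using assms by (simp add: field_simps)
  moreover have "r * t < t" using assms by simp
  ultimately have "1 \<le> (t - 1) / (r * t - 1)" by (subst le_divide_eq_1_pos) linarith+
  then have "0 \<le> ln ((t - 1) / (r * t - 1))" by simp
  then show "0 \<le> ln ((t - 1) / (r * t - 1)) / (t * ((ln (t - 1))\<^sup>2 + pi\<^sup>2))"
    using assms by (intro divide_nonneg_nonneg mult_nonneg_nonneg add_nonneg_nonneg) auto
qed

lemma sigma_r_measurable [measurable]: "sigma_r r \<in> borel_measurable borel"
  unfolding sigma_r_def by measurable

text \<open>
  The measure \<open>\<sigma>\<^sub>r(t) dt\<close> on the real line. Integrating against it, rather than multiplying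
  the integrand by \<open>\<sigma>\<^sub>r\<close>, needs no convention for the infinite value of \<open>\<sigma>\<^sub>r\<close>. It is only
  used on \<open>{1<..}\<close>.
\<close>

definition sigma_dt :: "real \<Rightarrow> real measure" where
  "sigma_dt r = density lborel (sigma_r r)"

definition mu_r :: "real \<Rightarrow> real measure" where
  "mu_r r = measure_of {0..} (sets (restrict_space borel {0..}))
     (\<lambda>A. ennreal r * emeasure (return borel 0) A +
          emeasure (density lborel (\<lambda>t. indicator {1<..} t * sigma_r r t)) A)"

lemma space_mu_r [simp]: "space (mu_r r) = {0..}"
  unfolding mu_r_def by (rule space_measure_of) (auto simp: sets_restrict_space)

lemma sets_mu_r [simp]: "sets (mu_r r) = sets (restrict_space borel {0..})"
  using sets.sets_measure_of_eq[of "restrict_space borel {0::real..}"]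
  unfolding mu_r_def by (simp add: space_restrict_space)

lemma emeasure_mu_r:
  assumes "A \<in> sets (restrict_space borel {0..})"
  shows "emeasure (mu_r r) A =
    ennreal r * indicator A 0 + (\<integral>\<^sup>+t\<in>A \<inter> {1<..}. sigma_r r t \<partial>lborel)"
proof -
  let ?S = "sets (restrict_space borel {0::real..})"
  let ?N = "density lborel (\<lambda>t. indicator {1<..} t * sigma_r r t)"
  let ?\<mu> = "\<lambda>A. ennreal r * emeasure (return borel 0) A + emeasure ?N A"
  have sub: "?S \<subseteq> sets borel"
    by (auto simp: sets_restrict_space)
  have "countably_additive ?S ?\<mu>"
  proof (rule countably_additiveI)
    fix B :: "nat \<Rightarrow> real set"
    assume B: "range B \<subseteq> ?S" "disjoint_family B" "\<Union> (range B) \<in> ?S"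
    have 1: "(\<Sum>i. emeasure (return borel 0) (B i)) = emeasure (return borel 0) (\<Union> (range B))"
      by (rule suminf_emeasure) (use B sub in auto)
    have 2: "(\<Sum>i. emeasure ?N (B i)) = emeasure ?N (\<Union> (range B))"
      by (rule suminf_emeasure) (use B sub in auto)
    show "(\<Sum>i. ?\<mu> (B i)) = ?\<mu> (\<Union> (range B))"
      by (simp add: 1 2 suminf_add[symmetric] ennreal_suminf_cmult)
  qed
  moreover have "positive ?S ?\<mu>" by (simp add: positive_def)
  moreover have "sigma_algebra {0..} ?S"
    using sets.sigma_algebra_axioms[of "restrict_space borel {0::real..}"]
    by (simp add: space_restrict_space)
  ultimately have "emeasure (mu_r r) A = ?\<mu> A"
    unfolding mu_r_def using assms by (intro emeasure_measure_of_sigma) auto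
  moreover have "A \<in> sets borel" using assms sub by auto
  ultimately show ?thesis
    by (auto simp: emeasure_density indicator_inter_arith mult_ac)
qed

end

theory Submission
  imports Defs "HOL-Real_Asymp.Real_Asymp"
begin

text \<open>
  Substituting $z = e^w - 1$ turns the slit plane into the strip $|\mathrm{Im}\, w| < \pi$ and
  $f_r(z)$ into $\mathrm{Log}(1 - r + r e^w) / w$. Cauchy's formula on the rectangles
  $[-n, n] \times [-h_n, h_n]$ with $h_n \to \pi$ and the kernel
  $e^v / (e^v - e^w) - e^v / (e^v - 1)$ gives $f_r(z) - r$. The vertical sides vanish in the limit,
  and the jump of the integrand across the lines $\mathrm{Im}\, v = \pm\pi$ is the density
  $\sigma_r$ written in $y = \log(t - 1)$; the passage to the limit is dominated although $\sigma_r$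
  has a logarithmic singularity at $1/r$. Letting $z \to \infty$ shows that $\sigma_r(t)\,dt$
  has mass $1 - r$, and all other claims are read off the representation; in (1), $m$ is the Laplace
  transform of $t\,\sigma_r(t)\,dt$, and the second integral in (6) is $\mathrm{Re} f_r(i) - r$.
\<close>

subsection \<open>The slit plane and the logarithmic strip\<close>

text \<open>The strip replaces the usual keyhole contour: the branch point -1 and infinity both move
  to the ends of the strip, so no small or large circles are needed. The obstacle at the right end
  is that e^v / (e^v - e^w) tends to 1, while the bound used for the logarithm grows like e^(Re v /
  2). Subtracting the kernel for 0 leaves a kernel of order e^(-|Re v|) at both ends; since f_r(0) =
  r, it also makes f_r(z) - r the quantity computed. The other obstacle is the zero of 1 - r + r e^v
  on the boundary lines, at e^v = -(1 - r)/r. By the reverse triangle inequality |1 - r + r e^v| is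
  at least |1 - r - r e^(Re v)|, whatever Im v is, so a single logarithmically singular function of
  Re v bounds the integrand on all horizontal sides. With t = 1 + e^(Re v) the resulting majorant
  is, up to a constant, (10 sqrt t - log|1 - rt|) / t^2, whose antiderivative is elementary.\<close>

lemma slit_plane_iff: "z \<in> slit_plane a \<longleftrightarrow> (Im z = 0 \<longrightarrow> a < Re z)"
  by (auto simp: slit_plane_def image_iff complex_eq_iff not_le)

lemma open_slit_plane [simp]: "open (slit_plane a)"
proof -
  have "closed (complex_of_real ` {..a})"
    by (rule closed_injective_linear_image) (auto simp: linear_iff inj_on_def scaleR_conv_of_real)
  then show ?thesis unfolding slit_plane_def by auto
qed

lemma connected_slit_plane [simp]: "connected (slit_plane a)"
  unfolding slit_plane_def
  by (intro simply_connected_imp_connected simply_connected_slotted_complex_plane_left)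

lemma slit_plane_scale_nonpos:
  assumes "z \<in> slit_plane (-1)" "0 < r" "r \<le> 1"
  shows "1 + of_real r * z \<notin> \<real>\<^sub>\<le>\<^sub>0"
proof
  assume "1 + of_real r * z \<in> \<real>\<^sub>\<le>\<^sub>0"
  then have *: "Im z = 0" "1 + r * Re z \<le> 0" using assms by (auto simp: complex_nonpos_Reals_iff)
  with assms(1) have "-1 < Re z" by (auto simp: slit_plane_iff)
  then have "r * (-1) < r * Re z" using assms(2) by (intro mult_strict_left_mono)
  with * assms(3) show False by simp
qed

lemma slit_plane_one_plus_nonpos: "z \<in> slit_plane (-1) \<Longrightarrow> 1 + z \<notin> \<real>\<^sub>\<le>\<^sub>0"
  using slit_plane_scale_nonpos[of z 1] by simp

lemma Ln_one_plus_eq_0_iff: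
  assumes "z \<in> slit_plane (-1)"
  shows "Ln (1 + z) = 0 \<longleftrightarrow> z = 0"
  using slit_plane_one_plus_nonpos[OF assms] 
  by (metis Ln_1 add.commute add_0 add_cancel_right_right exp_Ln exp_zero nonpos_Reals_zero_I)

text \<open>After division by z, numerator and denominator are difference quotients at 0, with
  limits r and 1.\<close>

lemma f_r_tendsto_0:
  assumes "0 < r"
  shows "(f_r r \<longlongrightarrow> of_real r) (at 0)"
proof -
  have D: "((\<lambda>z. Ln (1 + c * z) / z) \<longlongrightarrow> c) (at 0)" for c :: complex
  proof -
    have "((\<lambda>z. Ln (1 + c * z)) has_field_derivative c) (at 0)"
      by (auto intro!: derivative_eq_intros)
    then show ?thesis by (simp add: has_field_derivative_iff)
  qed
  have "((\<lambda>z. (Ln (1 + of_real r * z) / z) / (Ln (1 + 1 * z) / z)) \<longlongrightarrow> of_real r / 1) (at 0)"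
    by (intro tendsto_divide D) auto
  then show ?thesis unfolding div_by_1
    by (rule Lim_transform_eventually) (auto simp: f_r_def eventually_at_filter)
qed

text \<open>0 is the only zero of \<open>Ln (1 + z)\<close> in the slit plane, and the limit there
  is the assigned value r, so the singularity is removable.\<close>

lemma holomorphic_f_r:
  assumes "0 < r" "r < 1"
  shows "f_r r holomorphic_on slit_plane (-1)"
proof (rule no_isolated_singularity'[where K="{0}"])
  show "(f_r r \<longlongrightarrow> f_r r z) (at z within slit_plane (-1))" if "z \<in> {0}" for z
    using that f_r_tendsto_0[OF assms(1)] by (auto simp: f_r_def intro: tendsto_within_subset)
  have "(\<lambda>z. Ln (1 + of_real r * z) / Ln (1 + z)) holomorphic_on slit_plane (-1) - {0}"
    using assms slit_plane_scale_nonpos slit_plane_one_plus_nonpos Ln_one_plus_eq_0_iff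
    by (intro holomorphic_intros) auto
  then show "f_r r holomorphic_on slit_plane (-1) - {0}"
    by (rule holomorphic_transform) (auto simp: f_r_def)
qed auto

section \<open>The strip of height 2 pi and the exponential map\<close>

definition strip :: "complex set" where
  "strip = {w. \<bar>Im w\<bar> < pi}"

lemma strip_eq: "strip = {w. Im w < pi} \<inter> {w. Im w > -pi}"
  by (auto simp: strip_def)

lemma stripD: "w \<in> strip \<Longrightarrow> Im w < pi" "w \<in> strip \<Longrightarrow> - pi < Im w"
  by (simp_all add: strip_eq)

lemma open_strip [simp]: "open strip"
  unfolding strip_eq by (intro open_Int open_halfspace_Im_lt open_halfspace_Im_gt)

lemma convex_strip [simp]: "convex strip"
  unfolding strip_eq by (intro convex_Int convex_halfspace_Im_lt convex_halfspace_Im_gt)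

lemma exp_eq_on_strip:
  assumes "w \<in> strip" "w' \<in> strip" "exp w = exp w'"
  shows "w = w'"
proof (rule exp_complex_eqI)
  show "\<bar>Im w - Im w'\<bar> < 2 * pi"
    using stripD[OF assms(1)] stripD[OF assms(2)] by linarith
qed fact

lemma exp_minus_one_in_slit_plane:
  assumes "w \<in> strip"
  shows "exp w - 1 \<in> slit_plane (-1)"
proof -
  have "Re (exp w) > 0" if "Im (exp w) = 0"
  proof -
    have "sin (Im w) = 0" using that by (simp add: Im_exp)
    then have "Im w = 0" using stripD[OF assms] by (metis sin_eq_0_pi)
    then show ?thesis by (simp add: Re_exp)
  qed
  then show ?thesis by (auto simp: slit_plane_iff)
qed

lemma Ln_one_plus_in_strip: "z \<in> slit_plane (-1) \<Longrightarrow> Ln (1 + z) \<in> strip"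
  using slit_plane_one_plus_nonpos[of z] Im_Ln_less_pi[of "1+z"] mpi_less_Im_Ln[of "1+z"]
  by (force simp: strip_def)

lemma holomorphic_f_r_exp:
  assumes "0 < r" "r < 1"
  shows "(\<lambda>w. f_r r (exp w - 1)) holomorphic_on strip"
proof -
  have "(f_r r \<circ> (\<lambda>w. exp w - 1)) holomorphic_on strip"
    using exp_minus_one_in_slit_plane
    by (intro holomorphic_on_compose_gen[OF _ holomorphic_f_r[OF assms]] holomorphic_intros) auto
  then show ?thesis by (simp add: o_def)
qed

lemma f_r_exp_eq:
  assumes "w \<in> strip" "w \<noteq> 0"
  shows "f_r r (exp w - 1) = Ln (1 - of_real r + of_real r * exp w) / w"
proof -
  have "exp w \<noteq> 1" using exp_eq_on_strip[of w 0] assms by (auto simp: strip_def)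
  moreover have "Ln (exp w) = w" using stripD[OF assms(1)] by (intro Ln_exp) auto
  ultimately show ?thesis by (simp add: f_r_def algebra_simps)
qed

text \<open>exp is injective on the strip, so the kernel has a single pole there, at w, with residue
  1. Writing e^v - e^w = (v - w) q(v) with q holomorphic and zero-free reduces the claim to Cauchy's
  formula for H e^v / q, whose value at w is H w because q w = e^w.\<close>

lemma Cauchy_exp_kernel_rectpath:
  assumes H: "H holomorphic_on strip" and w: "w \<in> box a b" and ab: "cbox a b \<subseteq> strip"
  shows "((\<lambda>v. H v * exp v / (exp v - exp w)) has_contour_integral 2 * pi * \<i> * H w) (rectpath a b)"
proof -
  define q where "q = (\<lambda>v. if v = w then exp w else (exp v - exp w) / (v - w))"
  have ws: "w \<in> strip" using w ab box_subset_cbox by blast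
  have less: "Re a < Re b" "Im a < Im b" using w by (auto simp: in_box_complex_iff)
  have q: "q holomorphic_on strip"
    using pole_lemma_open[of exp strip w, OF holomorphic_on_exp open_strip]
    unfolding q_def DERIV_imp_deriv[OF DERIV_exp] .
  have q0: "q v \<noteq> 0" if "v \<in> strip" for v
    using that ws exp_eq_on_strip by (auto simp: q_def)
  have img: "path_image (rectpath a b) \<subseteq> strip - {w}"
    using path_image_rectpath_subset_cbox[of a b] path_image_rectpath_inter_box[of a b] less w ab
    by auto
  have "((\<lambda>v. (H v * exp v / q v) / (v - w)) has_contour_integral
          2 * pi * \<i> * winding_number (rectpath a b) w * (H w * exp w / q w)) (rectpath a b)"
    using H q q0 ws img
    by (intro Cauchy_integral_formula_convex_simple[where S=strip] holomorphic_intros)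
       (auto simp: interior_open)
  then have "((\<lambda>v. (H v * exp v / q v) / (v - w)) has_contour_integral 2 * pi * \<i> * H w) (rectpath a b)"
    using winding_number_rectpath[OF w] by (simp add: q_def)
  then show ?thesis
  proof (rule has_contour_integral_eq)
    fix v assume "v \<in> path_image (rectpath a b)"
    then have "v \<noteq> w" using img by auto
    then show "H v * exp v / q v / (v - w) = H v * exp v / (exp v - exp w)"
      by (simp add: q_def)
  qed
qed

subsection \<open>Contour integrals over rectangles\<close>

lemma has_contour_integral_linepath_horizontal:
  assumes "a < b"
  shows "(f has_contour_integral I) (linepath (Complex a c) (Complex b c)) \<longleftrightarrow>
         ((\<lambda>x. f (Complex x c)) has_integral I) {a..b}"
proof -
  have 1: "linepath (Complex a c) (Complex b c) t = linepath (of_real a) (of_real b) t + Complex 0 c"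
    for t by (simp add: linepath_def complex_eq_iff algebra_simps)
  have 2: "Complex b c - Complex a c = of_real b - of_real a" by (simp add: complex_eq_iff)
  have 3: "of_real x + Complex 0 c = Complex x c" for x by (simp add: complex_eq_iff)
  have "(f has_contour_integral I) (linepath (Complex a c) (Complex b c)) \<longleftrightarrow>
      ((\<lambda>z. f (z + Complex 0 c)) has_contour_integral I) (linepath (of_real a) (of_real b))"
    unfolding has_contour_integral_linepath 1 2 ..
  also have "\<dots> \<longleftrightarrow> ((\<lambda>x. f (Complex x c)) has_integral I) {a..b}"
    using assms by (subst has_contour_integral_linepath_Reals_iff) (auto simp: 3)
  finally show ?thesis .
qed

text \<open>The top side runs from right to left, which gives the difference bottom minus top. Each
  vertical side has length 2h and so contributes at most 2hB.\<close>

lemma rectpath_horizontal_sides_bound: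
  assumes I: "(f has_contour_integral I) (rectpath (Complex (-R) (-h)) (Complex R h))"
    and R: "0 < R" "0 < h"
    and cont: "continuous_on (path_image (rectpath (Complex (-R) (-h)) (Complex R h))) f"
    and B: "\<And>v. \<bar>Im v\<bar> \<le> h \<Longrightarrow> \<bar>Re v\<bar> = R \<Longrightarrow> norm (f v) \<le> B"
  shows "norm (integral {-R..R} (\<lambda>x. f (Complex x (-h)) - f (Complex x h)) - I) \<le> 4 * h * B"
proof -
  let ?a = "Complex (-R) (-h)" and ?b = "Complex R (-h)" and ?c = "Complex R h" and ?d = "Complex (-R) h"
  have img: "path_image (rectpath ?a ?c)
      = closed_segment ?a ?b \<union> closed_segment ?b ?c \<union> closed_segment ?c ?d \<union> closed_segment ?d ?a"
    by (auto simp: rectpath_def Let_def path_image_join)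
  have "0 \<le> B" using B[of "Complex R 0"] R by (intro order_trans[OF norm_ge_zero]) auto
  have ex: "\<exists>i. (f has_contour_integral i) (linepath p q)"
    if "closed_segment p q \<subseteq> path_image (rectpath ?a ?c)" for p q
    using contour_integrable_continuous_linepath[OF continuous_on_subset[OF cont that]]
    by (simp add: contour_integrable_on_def)
  obtain i1 where i1: "(f has_contour_integral i1) (linepath ?a ?b)" using ex[of ?a ?b] img by blast
  obtain i2 where i2: "(f has_contour_integral i2) (linepath ?b ?c)" using ex[of ?b ?c] img by blast
  obtain i3 where i3: "(f has_contour_integral i3) (linepath ?c ?d)" using ex[of ?c ?d] img by blast
  obtain i4 where i4: "(f has_contour_integral i4) (linepath ?d ?a)" using ex[of ?d ?a] img by blast
  have "(f has_contour_integral (i1 + (i2 + (i3 + i4)))) (rectpath ?a ?c)"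
    unfolding rectpath_def Let_def complex.sel
    by (intro has_contour_integral_join i1 i2 i3 i4 valid_path_join valid_path_linepath) auto
  then have sum: "I = i1 + (i2 + (i3 + i4))" using I by (metis contour_integral_unique)
  have h1: "((\<lambda>x. f (Complex x (-h))) has_integral i1) {-R..R}"
    using i1 R by (subst (asm) has_contour_integral_linepath_horizontal) auto
  have "(f has_contour_integral -i3) (linepath ?d ?c)"
    using has_contour_integral_reverse_linepath[OF i3] by simp
  then have h3: "((\<lambda>x. f (Complex x h)) has_integral -i3) {-R..R}"
    using R by (subst (asm) has_contour_integral_linepath_horizontal) auto
  have eq: "integral {-R..R} (\<lambda>x. f (Complex x (-h)) - f (Complex x h)) = i1 + i3"
    using has_integral_diff[OF h1 h3] by (simp add: integral_unique)
  have seg: "\<bar>Im v\<bar> \<le> h \<and> \<bar>Re v\<bar> = R" if "v \<in> closed_segment ?b ?c \<union> closed_segment ?d ?a" for v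
    using that R by (auto simp: closed_segment_same_Re closed_segment_eq_real_ivl)
  have "norm i2 \<le> B * norm (?c - ?b)"
    using i2 \<open>0 \<le> B\<close> by (rule has_contour_integral_bound_linepath) (use seg B in auto)
  moreover have "norm i4 \<le> B * norm (?a - ?d)"
    using i4 \<open>0 \<le> B\<close> by (rule has_contour_integral_bound_linepath) (use seg B in auto)
  moreover have "norm (?c - ?b) = 2 * h" "norm (?a - ?d) = 2 * h"
    using R by (simp_all add: cmod_eq_Im)
  ultimately have "norm i2 + norm i4 \<le> 4 * h * B" by (simp add: mult_ac)
  moreover have "norm (i1 + i3 - I) \<le> norm i2 + norm i4"
    using norm_triangle_ineq[of "i2" "i4"] norm_minus_cancel[of "i2 + i4"] by (simp add: sum)
  ultimately show ?thesis by (simp add: eq)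
qed

text \<open>With s = e^(Re v), p = e^(Re w) and c = cos(Im v - Im w), the law of cosines gives s^2 +
  p^2 - 2spc for the square of the right-hand side. The hypotheses keep the angle at least d away
  from multiples of 2 pi, so c <= cos d, and s^2 + p^2 - 2sp cos d splits into nonnegative multiples
  of (s + p)^2 and (s - p)^2, of which the first is kept.\<close>

lemma norm_exp_diff_lower_bound:
  fixes w v :: complex
  assumes "0 \<le> d" "d \<le> pi" "d \<le> \<bar>Im v - Im w\<bar>" "\<bar>Im v - Im w\<bar> \<le> 2 * pi - d"
  shows "sqrt ((1 - cos d) / 2) * (exp (Re v) + exp (Re w)) \<le> norm (exp v - exp w)"
proof -
  define s p c where "s = exp (Re v)" and "p = exp (Re w)" and "c = cos (Im v - Im w)"
  have "s > 0" "p > 0" by (auto simp: s_def p_def)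
  have "c \<le> cos d"
  proof (cases "\<bar>Im v - Im w\<bar> \<le> pi")
    case True
    then show ?thesis
      using assms cos_monotone_0_pi_le[of d "\<bar>Im v - Im w\<bar>"] by (simp add: c_def cos_abs_real)
  next
    case False
    have "cos (2 * pi - \<bar>Im v - Im w\<bar>) \<le> cos d"
      using False assms by (intro cos_monotone_0_pi_le) auto
    then show ?thesis by (simp add: c_def cos_diff cos_abs_real)
  qed
  have c1: "0 \<le> 1 + cos d" using cos_ge_minus_one[of d] by linarith
  have expand: "(s * a - p * b)\<^sup>2 + (s * a' - p * b')\<^sup>2
      = s\<^sup>2 * (a'\<^sup>2 + a\<^sup>2) + p\<^sup>2 * (b'\<^sup>2 + b\<^sup>2) - 2 * s * p * (a * b + a' * b')" for a b a' b'
    by (simp add: power2_eq_square algebra_simps)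
  have "(norm (exp v - exp w))\<^sup>2 = (s * cos (Im v) - p * cos (Im w))\<^sup>2 + (s * sin (Im v) - p * sin (Im w))\<^sup>2"
    by (simp add: cmod_power2 Re_exp Im_exp s_def p_def)
  also have "\<dots> = s\<^sup>2 * ((sin (Im v))\<^sup>2 + (cos (Im v))\<^sup>2) + p\<^sup>2 * ((sin (Im w))\<^sup>2 + (cos (Im w))\<^sup>2) - 2 * s * p * c"
    unfolding c_def cos_diff by (rule expand)
  also have "\<dots> = s\<^sup>2 + p\<^sup>2 - 2 * (s * p) * c"
    by (simp only: sin_cos_squared_add mult_1_right mult.assoc)
  also have "\<dots> \<ge> s\<^sup>2 + p\<^sup>2 - 2 * (s * p) * cos d"
    using \<open>c \<le> cos d\<close> \<open>s > 0\<close> \<open>p > 0\<close> by (simp add: mult_left_mono)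
  also have "s\<^sup>2 + p\<^sup>2 - 2 * (s * p) * cos d = (1 - cos d) / 2 * (s + p)\<^sup>2 + (1 + cos d) / 2 * (s - p)\<^sup>2"
    by (simp add: power2_eq_square field_simps)
  also have "\<dots> \<ge> (1 - cos d) / 2 * (s + p)\<^sup>2"
    using mult_nonneg_nonneg[OF c1, of "(s - p)\<^sup>2"] by simp
  also have "(1 - cos d) / 2 * (s + p)\<^sup>2 = (sqrt ((1 - cos d) / 2) * (s + p))\<^sup>2"
    by (simp add: power_mult_distrib)
  finally show ?thesis
    unfolding s_def p_def by (rule power2_le_imp_le) auto
qed

text \<open>The bound depends on Re v alone, so it is uniform as Im v approaches pi or -pi. The
  argument of \<open>Ln\<close> has modulus between |1 - r - r e^(Re v)| and 1 + e^(Re v). The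
  growing logarithm is weakened to a square root, which suits the explicit antiderivative in
  \<open>set_integrable_log_dominator\<close>.\<close>

lemma norm_Ln_affine_exp_le:
  assumes r: "0 < r" "r < 1" and v: "v \<in> strip" and u: "1 - r - r * exp (Re v) \<noteq> 0"
  shows "norm (Ln (1 - of_real r + of_real r * exp v))
       \<le> 10 * sqrt (1 + exp (Re v)) - ln \<bar>1 - r - r * exp (Re v)\<bar>"
proof -
  define s u where "s = exp (Re v)" and "u = \<bar>1 - r - r * exp (Re v)\<bar>"
  let ?L = "1 - of_real r + of_real r * exp v"
  have "0 < s" "0 < u" using u by (auto simp: s_def u_def)
  have rs: "0 < r * s" "r * s < s" using r \<open>0 < s\<close> by auto
  have u_le: "u \<le> 1 + s" using r rs by (simp add: u_def s_def[symmetric] abs_le_iff)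
  have eq: "norm (1 - of_real r :: complex) = 1 - r"
    using r by (metis abs_of_pos diff_gt_0_iff_gt norm_of_real of_real_1 of_real_diff)
  have eq2: "norm (of_real r * exp v) = r * s"
    using r by (simp add: norm_mult s_def norm_exp_eq_Re)
  have up: "norm ?L \<le> 1 + s"
    using norm_triangle_ineq[of "1 - of_real r" "of_real r * exp v"] r rs unfolding eq eq2 by simp
  have low: "u \<le> norm ?L"
    using norm_triangle_ineq3[of "1 - of_real r" "- (of_real r * exp v)"] r rs
    unfolding norm_minus_cancel eq eq2 u_def s_def[symmetric] by simp
  have L0: "?L \<noteq> 0" using low \<open>0 < u\<close> by auto
  have "norm (Ln ?L) \<le> \<bar>ln (norm ?L)\<bar> + pi"
    using cmod_le[of "Ln ?L"] L0 Im_Ln_le_pi[OF L0] mpi_less_Im_Ln[OF L0] by simp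
  moreover have "ln (norm ?L) \<le> ln (1 + s)" "ln u \<le> ln (norm ?L)" "ln u \<le> ln (1 + s)"
    using up low u_le \<open>0 < u\<close> L0 \<open>0 < s\<close> by auto
  moreover have "0 \<le> ln (1 + s)" using \<open>0 < s\<close> by simp
  \<comment> \<open>The term 2 ln (1 + s) - ln u dominates the absolute value of
    \<open>ln (norm ?L)\<close> for either sign. Here 2 ln (1 + s) costs 4 sqrt (1 + s) - 4 and pi
    costs 4 sqrt (1 + s), so 8 would do and 10 is a round constant.\<close>
  ultimately have "norm (Ln ?L) \<le> 2 * ln (1 + s) - ln u + pi" by linarith
  also have "ln (1 + s) \<le> 2 * (sqrt (1 + s) - 1)"
    using ln_le_minus_one[of "sqrt (1 + s)"] \<open>0 < s\<close> by (simp add: ln_sqrt)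
  also have "pi \<le> 4 * sqrt (1 + s)"
    using pi_less_4 \<open>0 < s\<close> real_sqrt_ge_1_iff[of "1 + s"] by linarith
  finally have "norm (Ln ?L) \<le> 8 * sqrt (1 + s) - 4 - ln u" by simp
  moreover have "0 \<le> sqrt (1 + s)" using \<open>0 < s\<close> by simp
  ultimately have "norm (Ln ?L) \<le> 10 * sqrt (1 + s) - ln u" by linarith
  then show ?thesis by (simp add: u_def s_def)
qed

subsection \<open>The substitution $t = 1 + e^y$ and an integrable majorant\<close>

text \<open>Stated for measures, so that integrability and integrals of vector-valued functions both
  follow. The substitution rule is applied on the compact intervals [-n, n], and monotone
  convergence removes the cutoff.\<close>

lemma distr_one_plus_exp:
  "distr (density lborel (\<lambda>y. ennreal (exp y))) borel (\<lambda>y. 1 + exp y)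
     = density lborel (\<lambda>t::real. ennreal (indicator {1<..} t))"
proof (rule measure_eqI)
  fix A :: "real set"
  assume "A \<in> sets (distr (density lborel (\<lambda>y. ennreal (exp y))) borel (\<lambda>y. 1 + exp y))"
  then have A [measurable]: "A \<in> sets borel" by simp
  let ?L = "\<lambda>n y. ennreal (indicator A (1 + exp y) * exp y * indicator {- real n..real n} y)"
  let ?R = "\<lambda>n t. ennreal (indicator A t * indicator {1 + exp (- real n)..1 + exp (real n)} t)"
  have eq: "(\<integral>\<^sup>+y. ?L n y \<partial>lborel) = (\<integral>\<^sup>+t. ?R n t \<partial>lborel)" for n
    by (rule nn_integral_substitution[symmetric])
       (auto intro!: derivative_eq_intros continuous_intros simp: set_borel_measurable_def)
  have L: "(\<lambda>n. \<integral>\<^sup>+y. ?L n y \<partial>lborel)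
      \<longlonglongrightarrow> (\<integral>\<^sup>+y. ennreal (exp y) * indicator ((\<lambda>y. 1 + exp y) -` A) y \<partial>lborel)"
  proof (rule nn_integral_LIMSEQ)
    show "incseq ?L"
      by (auto simp: incseq_def le_fun_def split: split_indicator intro!: ennreal_leI)
    show "(\<lambda>n. ?L n y) \<longlonglongrightarrow> ennreal (exp y) * indicator ((\<lambda>y. 1 + exp y) -` A) y" for y
    proof (rule tendsto_eventually)
      obtain N :: nat where "\<bar>y\<bar> \<le> real N" using real_arch_simple by blast
      then show "eventually (\<lambda>n. ?L n y = ennreal (exp y) * indicator ((\<lambda>y. 1 + exp y) -` A) y) sequentially"
        by (intro eventually_sequentiallyI[of N]) (auto split: split_indicator)
    qed
  qed auto
  have R: "(\<lambda>n. \<integral>\<^sup>+t. ?R n t \<partial>lborel)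
      \<longlonglongrightarrow> (\<integral>\<^sup>+t. ennreal (indicator {1<..} t) * indicator A t \<partial>lborel)"
  proof (rule nn_integral_LIMSEQ)
    have sub: "{1 + exp (- real n)..1 + exp (real n)} \<subseteq> {1 + exp (- real (Suc n))..1 + exp (real (Suc n))}" for n
      by auto
    show "incseq ?R"
      by (intro incseq_SucI le_funI ennreal_leI mult_left_mono indicator_leI subsetD[OF sub]) auto
    show "(\<lambda>n. ?R n t) \<longlonglongrightarrow> ennreal (indicator {1<..} t) * indicator A t" for t
    proof (cases "1 < t")
      case True
      obtain N :: nat where N: "\<bar>ln (t - 1)\<bar> \<le> real N" using real_arch_simple by blast
      have "1 + exp (- real n) \<le> t \<and> t \<le> 1 + exp (real n)" if "N \<le> n" for n
      proof -
        have "exp (- real n) \<le> exp (ln (t - 1))" "exp (ln (t - 1)) \<le> exp (real n)"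
          using N that by auto
        then show ?thesis using True by simp
      qed
      then show ?thesis using True
        by (intro tendsto_eventually eventually_sequentiallyI[of N]) (auto split: split_indicator)
    next
      case False
      then have "\<not> 1 + exp x \<le> t" for x using exp_gt_zero[of x] by linarith
      then show ?thesis using False by (auto split: split_indicator)
    qed
  qed auto
  have "(\<integral>\<^sup>+y. ennreal (exp y) * indicator ((\<lambda>y. 1 + exp y) -` A) y \<partial>lborel)
      = (\<integral>\<^sup>+t. ennreal (indicator {1<..} t) * indicator A t \<partial>lborel)"
    by (rule LIMSEQ_unique[OF L[unfolded eq] R])
  then show "emeasure (distr (density lborel (\<lambda>y. ennreal (exp y))) borel (\<lambda>y. 1 + exp y)) A
      = emeasure (density lborel (\<lambda>t. ennreal (indicator {1<..} t))) A"
    using measurable_sets[OF _ A, of "\<lambda>y. 1 + exp y" borel]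
    by (subst emeasure_distr) (auto simp: emeasure_density)
qed simp

lemma
  fixes f :: "real \<Rightarrow> 'b::{banach, second_countable_topology}"
  assumes [measurable]: "f \<in> borel_measurable borel"
  shows set_integrable_one_plus_exp_iff:
      "set_integrable lborel {1<..} f \<longleftrightarrow> integrable lborel (\<lambda>y. exp y *\<^sub>R f (1 + exp y))"
    and set_integral_one_plus_exp:
      "(LINT t:{1<..}|lborel. f t) = (LINT y|lborel. exp y *\<^sub>R f (1 + exp y))"
proof -
  let ?D = "density lborel (\<lambda>y::real. ennreal (exp y))"
  have "set_integrable lborel {1<..} f \<longleftrightarrow> integrable (distr ?D borel (\<lambda>y. 1 + exp y)) f"
    unfolding distr_one_plus_exp set_integrable_def by (subst integrable_density) auto
  also have "\<dots> \<longleftrightarrow> integrable lborel (\<lambda>y. exp y *\<^sub>R f (1 + exp y))"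
    by (subst integrable_distr_eq) (auto simp: integrable_density)
  finally show "set_integrable lborel {1<..} f \<longleftrightarrow> integrable lborel (\<lambda>y. exp y *\<^sub>R f (1 + exp y))" .
  have "(LINT t:{1<..}|lborel. f t) = integral\<^sup>L (distr ?D borel (\<lambda>y. 1 + exp y)) f"
    unfolding distr_one_plus_exp set_lebesgue_integral_def by (subst integral_density) auto
  also have "\<dots> = (LINT y|lborel. exp y *\<^sub>R f (1 + exp y))"
    by (subst integral_distr) (auto simp: integral_density)
  finally show "(LINT t:{1<..}|lborel. f t) = (LINT y|lborel. exp y *\<^sub>R f (1 + exp y))" .
qed

text \<open>F is an antiderivative: its first term accounts for 10 t^(-3/2), and in the other two
  the contributions r/t cancel, leaving -ln|1 - rt| / t^2. F has finite limits at 1, at 1/r (because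
  x ln|x| tends to 0) and at infinity. As the integrand is nonnegative, it is integrable on both
  sides of 1/r.\<close>

lemma set_integrable_log_dominator:
  assumes r: "0 < r" "r < 1"
  shows "set_integrable lborel {1<..} (\<lambda>t. (10 * sqrt t - ln \<bar>1 - r * t\<bar>) / t\<^sup>2)"
proof -
  let ?D = "\<lambda>t. (10 * sqrt t - ln \<bar>1 - r * t\<bar>) / t\<^sup>2"
  define F where "F = (\<lambda>t. - 20 / sqrt t + (1 - r * t) * ln \<bar>1 - r * t\<bar> / t + r * ln t)"
  have deriv: "DERIV F t :> ?D t" if "1 < t" "t \<noteq> 1 / r" for t
  proof -
    have nz: "1 - r * t \<noteq> 0" using that r by (auto simp: field_simps)
    have s: "sqrt t * sqrt t = t" using that by simp
    have ln_abs: "((\<lambda>t. ln \<bar>1 - r * t\<bar>) has_real_derivative (- r / (1 - r * t))) (at t)"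
    proof (cases "0 < 1 - r * t")
      case True
      have "((\<lambda>t. ln (1 - r * t)) has_real_derivative (- r / (1 - r * t))) (at t)"
        using True by (auto intro!: derivative_eq_intros)
      moreover have "eventually (\<lambda>t. 0 < 1 - r * t) (nhds t)"
        using True by (intro order_tendstoD(1)[of _ "1 - r * t"] tendsto_intros filterlim_ident) 
      then have ev: "eventually (\<lambda>t. ln (1 - r * t) = ln \<bar>1 - r * t\<bar>) (nhds t)"
        by eventually_elim auto
      ultimately show ?thesis using DERIV_cong_ev[OF refl ev refl] by simp
    next
      case False
      have "((\<lambda>t. ln (r * t - 1)) has_real_derivative (- r / (1 - r * t))) (at t)"
        using False nz by (auto intro!: derivative_eq_intros simp: divide_simps) (simp add: algebra_simps)
      moreover have "eventually (\<lambda>t. 1 - r * t < 0) (nhds t)"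
        using False nz by (intro order_tendstoD(2)[of _ "1 - r * t"] tendsto_intros filterlim_ident) auto
      then have ev: "eventually (\<lambda>t. ln (r * t - 1) = ln \<bar>1 - r * t\<bar>) (nhds t)"
        by eventually_elim auto
      ultimately show ?thesis using DERIV_cong_ev[OF refl ev refl] by simp
    qed
    \<comment> \<open>\<open>G\<close> keeps ln|1 - rt| opaque, so that its derivative enters only
      through \<open>ln_abs\<close>.\<close>
    define G where "G = (\<lambda>t. ln \<bar>1 - r * t\<bar>)"
    have G: "DERIV G t :> - r / (1 - r * t)" unfolding G_def by (rule ln_abs)
    have "DERIV (\<lambda>t. - 20 / sqrt t + (1 - r * t) * G t / t + r * ln t) t :> (10 * sqrt t - G t) / t\<^sup>2"
      using that nz
      by (auto intro!: derivative_eq_intros G) (simp add: field_simps power2_eq_square s)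
    then show ?thesis by (simp add: F_def G_def)
  qed
  have cont: "isCont ?D t" if "1 < t" "t \<noteq> 1 / r" for t
    using that r by (intro continuous_intros) (auto simp: field_simps)
  have nonneg: "0 \<le> ?D t" if "1 < t" for t
  proof -
    have "ln \<bar>1 - r * t\<bar> \<le> 10 * sqrt t"
    \<comment> \<open>At t = 1/r the default value ln 0 = 0 leaves only 0 <= 10 sqrt t.\<close>
    proof (cases "1 - r * t = 0")
      case False
      have "r * t < t" "0 < r * t" using r that by auto
      then have "\<bar>1 - r * t\<bar> \<le> t" using that by linarith
      then have "ln \<bar>1 - r * t\<bar> \<le> ln t" using False that by (subst ln_le_cancel_iff) auto
      also have "\<dots> \<le> 2 * sqrt t" using ln_le_minus_one[of "sqrt t"] that by (simp add: ln_sqrt)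
      also have "\<dots> \<le> 10 * sqrt t" using that by simp
      finally show ?thesis .
    qed (use that in auto)
    then show ?thesis by simp
  qed
  have lim1: "(F \<longlongrightarrow> - 20 + (1 - r) * ln (1 - r)) (at_right 1)"
  proof -
    have "isCont F 1" unfolding F_def using r by (intro continuous_intros) auto
    then show ?thesis using r by (simp add: F_def isCont_def filterlim_at_split)
  qed
  have limxlnx: "((\<lambda>x. x * ln \<bar>x\<bar>) \<longlongrightarrow> 0) (at (0::real))"
    unfolding filterlim_at_split by (intro conjI; real_asymp)
  have lim2: "(F \<longlongrightarrow> - 20 / sqrt (1 / r) + 0 / (1 / r) + r * ln (1 / r)) (at (1 / r))"
  proof -
    have "filterlim (\<lambda>t. 1 - r * t) (at 0) (at (1 / r))"
    proof (rule filterlim_atI)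
      have "((\<lambda>t. 1 - r * t) \<longlongrightarrow> 1 - r * (1 / r)) (at (1 / r))" by (intro tendsto_intros)
      then show "((\<lambda>t. 1 - r * t) \<longlongrightarrow> 0) (at (1 / r))" using r by simp
    qed (use r in \<open>auto simp: eventually_at_filter field_simps\<close>)
    from filterlim_compose[OF limxlnx this] show ?thesis unfolding F_def using r
      by (intro tendsto_intros) auto
  qed
  have lim3: "(F \<longlongrightarrow> - (r * ln r)) at_top"
  proof -
    have "((\<lambda>t. - 20 / sqrt t + (1 - r * t) * ln (r * t - 1) / t + r * ln t) \<longlongrightarrow> - (r * ln r)) at_top"
      using r by real_asymp
    moreover have "eventually (\<lambda>t. - 20 / sqrt t + (1 - r * t) * ln (r * t - 1) / t + r * ln t = F t) at_top"
      using eventually_gt_at_top[of "1 / r"] by eventually_elim (use r in \<open>auto simp: F_def field_simps\<close>)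
    ultimately show ?thesis using Lim_transform_eventually by blast
  qed
  have "set_integrable lborel (einterval 1 (1 / r)) ?D"
  proof (rule interval_integral_FTC_nonneg)
    show "1 < ereal (1 / r)" using r by simp
    show "((F \<circ> real_of_ereal) \<longlongrightarrow> - 20 + (1 - r) * ln (1 - r)) (at_right 1)"
      using lim1 by (simp add: one_ereal_def ereal_tendsto_simps1)
    show "((F \<circ> real_of_ereal) \<longlongrightarrow> - 20 / sqrt (1 / r) + 0 / (1 / r) + r * ln (1 / r)) (at_left (ereal (1 / r)))"
      using lim2 by (simp add: ereal_tendsto_simps1 filterlim_at_split)
  qed (use deriv cont nonneg in \<open>auto simp: one_ereal_def\<close>)
  moreover have "set_integrable lborel (einterval (1 / r) \<infinity>) ?D"
  proof (rule interval_integral_FTC_nonneg)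
    show "((F \<circ> real_of_ereal) \<longlongrightarrow> - 20 / sqrt (1 / r) + 0 / (1 / r) + r * ln (1 / r)) (at_right (ereal (1 / r)))"
      using lim2 by (simp add: ereal_tendsto_simps1 filterlim_at_split)
    show "((F \<circ> real_of_ereal) \<longlongrightarrow> - (r * ln r)) (at_left \<infinity>)"
      using lim3 by (simp add: ereal_tendsto_simps1)
    have "1 < t" if "1 / r < t" for t using that r by (smt (verit) less_divide_eq_1_pos)
    then show "\<And>x. ereal (1 / r) < ereal x \<Longrightarrow> ereal x < \<infinity> \<Longrightarrow> DERIV F x :> ?D x"
      "\<And>x. ereal (1 / r) < ereal x \<Longrightarrow> ereal x < \<infinity> \<Longrightarrow> isCont ?D x"
      "AE x in lborel. ereal (1 / r) < ereal x \<longrightarrow> ereal x < \<infinity> \<longrightarrow> 0 \<le> ?D x"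
      using deriv cont nonneg by auto
  qed auto
  moreover have "einterval 1 (1 / r) = {1<..<1 / r}" "einterval (1 / r) \<infinity> = {1 / r<..}"
    by (auto simp: einterval_def one_ereal_def)
  ultimately have "set_integrable lborel ({1<..<1 / r} \<union> {1 / r<..}) ?D"
    by (intro set_integrable_Un) auto
  moreover have "AE t in lborel. t \<noteq> 1 / r" by (rule AE_lborel_singleton)
  then have "AE t in lborel. indicator ({1<..<1 / r} \<union> {1 / r<..}) t *\<^sub>R ?D t = indicator {1<..} t *\<^sub>R ?D t"
  proof eventually_elim
    fix t assume "t \<noteq> 1 / r"
    moreover have "1 < 1 / r" using r by simp
    ultimately have "t \<in> {1<..<1 / r} \<union> {1 / r<..} \<longleftrightarrow> t \<in> {1<..}"
      unfolding Un_iff greaterThan_iff greaterThanLessThan_iff by linarith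
    then show "indicator ({1<..<1 / r} \<union> {1 / r<..}) t *\<^sub>R ?D t = indicator {1<..} t *\<^sub>R ?D t"
      by (simp only: indicator_def)
  qed
  ultimately show ?thesis
    unfolding set_integrable_def by (subst integrable_cong_AE[symmetric]) auto
qed

subsection \<open>Boundary values on the cut\<close>

text \<open>The value is \<open>0\<close> at \<open>t = 1 / r\<close>, where \<open>sigma_r\<close> is infinite.\<close>

definition sigma_real :: "real \<Rightarrow> real \<Rightarrow> real" where
  "sigma_real r t = enn2real (sigma_r r t)"

lemma sigma_real_measurable [measurable]: "sigma_real r \<in> borel_measurable borel"
  unfolding sigma_real_def by measurable

lemma sigma_real_nonneg [simp]: "0 \<le> sigma_real r t"
  by (simp add: sigma_real_def)

text \<open>Both branches in one formula, shaped like the boundary value of the logarithm: the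
  summand \<open>ln (t - 1)\<close> appears exactly where 1 - rt is negative and so has argument
  pi.\<close>

lemma sigma_real_eq:
  assumes "0 < r" "r < 1" "1 < t" "t \<noteq> 1 / r"
  shows "sigma_real r t = ((if r * t < 1 then 0 else ln (t - 1)) - ln \<bar>1 - r * t\<bar>) / (t * ((ln (t - 1))\<^sup>2 + pi\<^sup>2))"
proof (cases "t < 1 / r")
  case True
  then have "r * t < 1" using assms by (simp add: field_simps)
  then show ?thesis using True sigma_r_nonneg(1)[OF assms(1-3)]
    by (simp add: sigma_real_def sigma_r_def)
next
  case False
  then have *: "1 / r < t" using assms by auto
  then have "1 < r * t" using assms by (simp add: field_simps)
  then show ?thesis using * sigma_r_nonneg(2)[OF assms(1-3)] assms(3)
    by (simp add: sigma_real_def sigma_r_def ln_div)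
qed

lemma ennreal_sigma_real:
  assumes "t \<noteq> 1 / r"
  shows "ennreal (sigma_real r t) = sigma_r r t"
  using assms by (simp add: sigma_real_def sigma_r_def)

text \<open>Yields the boundary values from below once those from above are known.\<close>

lemma f_r_cnj:
  assumes "0 < r" "r < 1" "z \<in> slit_plane (-1)"
  shows "f_r r (cnj z) = cnj (f_r r z)"
proof -
  have "cnj (Ln (1 + of_real r * z)) = Ln (1 + of_real r * cnj z)" "cnj (Ln (1 + z)) = Ln (1 + cnj z)"
    using cnj_Ln[OF slit_plane_scale_nonpos[OF assms(3), of r]]
      cnj_Ln[OF slit_plane_one_plus_nonpos[OF assms(3)]] assms by simp_all
  then show ?thesis by (simp add: f_r_def)
qed

text \<open>The boundary value of the logarithm from the upper half-plane.\<close>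

definition cut_log :: "real \<Rightarrow> complex" where
  "cut_log u = Complex (ln \<bar>u\<bar>) (if u < 0 then pi else 0)"

text \<open>For u < 0 the values lie in the open upper half-plane, where Ln v = Ln (-v) + i pi, and
  -v tends to the positive number -u, at which \<open>Ln\<close> is continuous.\<close>

lemma tendsto_Ln_from_above:
  assumes "u \<noteq> 0" "(v \<longlongrightarrow> complex_of_real u) F" "\<And>n. 0 \<le> Im (v n)" "u < 0 \<Longrightarrow> \<forall>n. 0 < Im (v n)"
  shows "((\<lambda>n. Ln (v n)) \<longlongrightarrow> cut_log u) F"
proof (cases "0 < u")
  case True
  have "((\<lambda>n. Ln (v n)) \<longlongrightarrow> Ln (of_real u)) F"
    by (rule isCont_tendsto_compose[OF isCont_Ln' assms(2)]) (use True in \<open>auto simp: complex_nonpos_Reals_iff\<close>)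
  moreover have "Ln (of_real u) = cut_log u"
    using True by (simp add: cut_log_def complex_eq_iff Ln_of_real)
  ultimately show ?thesis by simp
next
  case False
  then have u: "u < 0" using assms by auto
  have eq: "Ln (v n) = Ln (- v n) + \<i> * pi" for n
    using Ln_minus[of "- v n"] assms(4) u by (smt (verit, best) minus_minus minus_zero uminus_complex.sel zero_complex.simps)
  have "((\<lambda>n. Ln (- v n) + \<i> * pi) \<longlongrightarrow> Ln (- of_real u) + \<i> * pi) F"
    by (intro tendsto_intros isCont_tendsto_compose[OF isCont_Ln' tendsto_minus[OF assms(2)]])
      (use u in \<open>auto simp: complex_nonpos_Reals_iff\<close>)
  moreover have "Ln (- of_real u) + \<i> * pi = cut_log u"
    using u Ln_of_real[of "-u"] by (simp add: cut_log_def complex_eq_iff)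
  ultimately show ?thesis by (simp add: eq)
qed

text \<open>On the line Im v = pi the argument of the logarithm is the real number 1 - r - r e^y. It
  is approached from above, because the imaginary part before the limit is r e^y sin(h n) >
  0.\<close>

lemma f_r_exp_upper_boundary:
  assumes r: "0 < r" "r < 1" and u: "1 - r - r * exp y \<noteq> 0"
    and h: "h \<longlonglongrightarrow> pi" "\<And>n. 0 < h n" "\<And>n. h n < pi"
  shows "(\<lambda>n. f_r r (exp (Complex y (h n)) - 1))
      \<longlonglongrightarrow> cut_log (1 - r - r * exp y) / Complex y pi"
proof -
  define v where "v = (\<lambda>n. 1 - of_real r + of_real r * exp (Complex y (h n)))"
  have lim: "(\<lambda>n. Complex y (h n)) \<longlonglongrightarrow> Complex y pi"
    by (intro tendsto_Complex tendsto_const h)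
  have "v \<longlonglongrightarrow> 1 - of_real r + of_real r * exp (Complex y pi)"
    unfolding v_def by (intro tendsto_intros tendsto_exp lim)
  also have "1 - of_real r + of_real r * exp (Complex y pi) = of_real (1 - r - r * exp y)"
    by (simp add: complex_eq_iff Re_exp Im_exp)
  finally have vlim: "v \<longlonglongrightarrow> of_real (1 - r - r * exp y)" .
  have "0 < Im (v n)" for n
    using r h sin_gt_zero[of "h n"] by (simp add: v_def Im_exp)
  then have "(\<lambda>n. Ln (v n)) \<longlonglongrightarrow> cut_log (1 - r - r * exp y)"
    by (intro tendsto_Ln_from_above u vlim) (auto simp: less_imp_le)
  then have "(\<lambda>n. Ln (v n) / Complex y (h n)) \<longlonglongrightarrow> cut_log (1 - r - r * exp y) / Complex y pi"
    by (intro tendsto_divide lim) (auto simp: complex_eq_iff)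
  moreover have "Ln (v n) / Complex y (h n) = f_r r (exp (Complex y (h n)) - 1)" for n
    unfolding v_def
    by (rule f_r_exp_eq[symmetric]) (use h(2)[of n] h(3)[of n] in \<open>auto simp: strip_eq complex_eq_iff\<close>)
  ultimately show ?thesis by simp
qed

text \<open>Here the density arises: with t = 1 + e^y one has 1 - r - r e^y = 1 - rt, and |y + i
  pi|^2 = (ln (t - 1))^2 + pi^2 is its denominator up to the factor t.\<close>

lemma Im_cut_log_divide:
  assumes r: "0 < r" "r < 1" and u: "1 - r - r * exp y \<noteq> 0"
  shows "Im (cut_log (1 - r - r * exp y) / Complex y pi) = pi * (1 + exp y) * sigma_real r (1 + exp y)"
proof -
  let ?t = "1 + exp y"
  have t: "1 < ?t" "?t \<noteq> 1 / r" using r u by (auto simp: field_simps)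
  have cancel: "pi * A / D = pi * t * (A / (t * D))" if "t \<noteq> 0" for A D t :: real
    using that by simp
  have ln_t: "ln (?t - 1) = y" by simp
  have 1: "1 - r - r * exp y = 1 - r * ?t" by (simp add: algebra_simps)
  have "Im (cut_log (1 - r * ?t) / Complex y pi)
      = pi * ((if r * ?t < 1 then 0 else y) - ln \<bar>1 - r * ?t\<bar>) / (y\<^sup>2 + pi\<^sup>2)"
    using u unfolding 1 by (auto simp: cut_log_def Im_divide algebra_simps)
  also have "\<dots> = pi * ?t * sigma_real r ?t"
    unfolding sigma_real_eq[OF r t] ln_t by (rule cancel) (use t(1) in linarith)
  finally show ?thesis unfolding 1 .
qed

text \<open>Under zeta = e^v - 1 and z = e^w - 1 this is (1/(zeta - z) - 1/zeta) dzeta/dv, the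
  difference of the Cauchy kernels for z and for 0.\<close>

definition strip_kernel :: "complex \<Rightarrow> complex \<Rightarrow> complex" where
  "strip_kernel w v = exp v / (exp v - exp w) - exp v / (exp v - 1)"

lemma strip_kernel_eq:
  assumes "exp v \<noteq> exp w" "exp v \<noteq> 1"
  shows "strip_kernel w v = exp v * (exp w - 1) / ((exp v - exp w) * (exp v - 1))"
  using assms by (simp add: strip_kernel_def field_simps)

text \<open>Both factors of the denominator in \<open>strip_kernel_eq\<close> are at least a
  multiple of 1 + e^(Re v), by \<open>norm_exp_diff_lower_bound\<close> for the poles w and 0. For t
  = 1 + e^y the remaining e^y / (1 + e^y)^2 dy is dt / t^2.\<close>

lemma norm_strip_kernel_le_horizontal:
  assumes d: "0 < d" "d < pi" and v: "v \<in> strip" "v \<noteq> w" "v \<noteq> 0" "w \<in> strip"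
    and dw: "d \<le> \<bar>Im v - Im w\<bar>" "\<bar>Im v - Im w\<bar> \<le> 2 * pi - d"
    and d0: "d \<le> \<bar>Im v\<bar>" "\<bar>Im v\<bar> \<le> 2 * pi - d"
  shows "norm (strip_kernel w v)
     \<le> norm (exp w - 1) / ((1 - cos d) / 2 * min 1 (exp (Re w))) * (exp (Re v) / (1 + exp (Re v))\<^sup>2)"
proof -
  define s p q where "s = exp (Re v)" and "p = exp (Re w)" and "q = (1 - cos d) / 2"
  have "s > 0" "p > 0" by (auto simp: s_def p_def)
  have "q > 0" using d cos_monotone_0_pi[of 0 d] by (simp add: q_def)
  have ne: "exp v \<noteq> exp w" "exp v \<noteq> 1"
    using exp_eq_on_strip[of v w] exp_eq_on_strip[of v 0] v by (auto simp: strip_def)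
  have "min 1 p * (1 + s) \<le> s + p"
  proof (cases "p \<le> 1")
    case True
    then have "p * s \<le> s" using \<open>s > 0\<close> by simp
    then show ?thesis using True by (simp add: min_def algebra_simps)
  qed (use \<open>s > 0\<close> in auto)
  then have "sqrt q * (min 1 p * (1 + s)) \<le> sqrt q * (s + p)"
    using \<open>q > 0\<close> by (intro mult_left_mono) auto
  also have "\<dots> \<le> norm (exp v - exp w)"
    using norm_exp_diff_lower_bound[of d v w] d dw by (simp add: s_def p_def q_def)
  finally have 1: "sqrt q * (min 1 p * (1 + s)) \<le> norm (exp v - exp w)" .
  have 2: "sqrt q * (1 + s) \<le> norm (exp v - 1)"
    using norm_exp_diff_lower_bound[of d v 0] d d0 by (simp add: s_def q_def add.commute)
  have "(sqrt q * (min 1 p * (1 + s))) * (sqrt q * (1 + s)) \<le> norm (exp v - exp w) * norm (exp v - 1)"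
    using 1 2 \<open>q > 0\<close> \<open>s > 0\<close> \<open>p > 0\<close> by (intro mult_mono) auto
  also have "(sqrt q * (min 1 p * (1 + s))) * (sqrt q * (1 + s)) = q * min 1 p * (1 + s)\<^sup>2"
    using \<open>q > 0\<close> by (simp add: power2_eq_square mult_ac)
  finally have "s * norm (exp w - 1) / (norm (exp v - exp w) * norm (exp v - 1))
      \<le> s * norm (exp w - 1) / (q * min 1 p * (1 + s)\<^sup>2)"
    using \<open>q > 0\<close> \<open>s > 0\<close> \<open>p > 0\<close> by (intro divide_left_mono mult_pos_pos mult_nonneg_nonneg) (auto simp: ne)
  also have "\<dots> = norm (exp w - 1) / (q * min 1 p) * (s / (1 + s)\<^sup>2)" by (simp add: mult_ac)
  finally show ?thesis
    unfolding strip_kernel_eq[OF ne] s_def p_def q_def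
    by (simp add: norm_divide norm_mult norm_exp_eq_Re)
qed

text \<open>On the vertical sides the reverse triangle inequality is enough, since there the modulus
  of exp v is far from the moduli e^(Re w) and 1 belonging to the poles.\<close>

lemma norm_strip_kernel_le_vertical:
  assumes "exp (Re v) \<noteq> exp (Re w)" "exp (Re v) \<noteq> 1"
  shows "norm (strip_kernel w v)
     \<le> exp (Re v) * norm (exp w - 1) / (\<bar>exp (Re v) - exp (Re w)\<bar> * \<bar>exp (Re v) - 1\<bar>)"
proof -
  have 1: "\<bar>exp (Re v) - exp (Re w)\<bar> \<le> norm (exp v - exp w)"
    using norm_triangle_ineq3[of "exp v" "exp w"] by (simp add: norm_exp_eq_Re)
  have 2: "\<bar>exp (Re v) - 1\<bar> \<le> norm (exp v - 1)"
    using norm_triangle_ineq3[of "exp v" 1] by (simp add: norm_exp_eq_Re)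
  have ne: "exp v \<noteq> exp w" "exp v \<noteq> 1" using assms 1 2 by auto
  have "exp (Re v) * norm (exp w - 1) / (norm (exp v - exp w) * norm (exp v - 1))
      \<le> exp (Re v) * norm (exp w - 1) / (\<bar>exp (Re v) - exp (Re w)\<bar> * \<bar>exp (Re v) - 1\<bar>)"
    using 1 2 assms ne by (intro divide_left_mono mult_mono mult_pos_pos) auto
  then show ?thesis
    unfolding strip_kernel_eq[OF ne] by (simp add: norm_divide norm_mult norm_exp_eq_Re)
qed

text \<open>The lower bound b for the denominator v is left free: it is taken to be 1 on the
  horizontal sides and |Re v| on the vertical ones.\<close>

lemma norm_f_r_exp_le:
  assumes r: "0 < r" "r < 1" and v: "v \<in> strip" "v \<noteq> 0" and u: "1 - r - r * exp (Re v) \<noteq> 0"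
    and b: "0 < b" "b \<le> norm v"
  shows "norm (f_r r (exp v - 1)) \<le> (10 * sqrt (1 + exp (Re v)) - ln \<bar>1 - r - r * exp (Re v)\<bar>) / b"
  unfolding f_r_exp_eq[OF v] norm_divide
  using norm_Ln_affine_exp_le[OF r v(1) u] b by (intro frac_le order_trans[OF norm_ge_zero]) auto

text \<open>The hypotheses on c admit both pi and -pi. The kernel has the same limit on both lines,
  so only f_r contributes to the jump.\<close>

lemma strip_kernel_boundary:
  assumes "z \<in> slit_plane (-1)" "exp w = 1 + z"
    and h: "(h \<longlongrightarrow> c) F" and c: "cos c = -1" "sin c = 0"
  shows "((\<lambda>n. strip_kernel w (Complex y (h n))) \<longlongrightarrow> 
            - complex_of_real (exp y) * z / ((of_real (1 + exp y) + z) * of_real (1 + exp y))) F"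
proof -
  have e: "exp (Complex y c) = - of_real (exp y)"
    using c by (simp add: complex_eq_iff Re_exp Im_exp)
  have n1: "1 + exp y + z \<noteq> 0"
  proof
    assume *: "1 + exp y + z = 0"
    have "Im z = 0" "Re z = - 1 - exp y" using arg_cong[OF *, of Im] arg_cong[OF *, of Re] by auto
    then show False using assms(1) exp_gt_zero[of y] by (auto simp: slit_plane_iff)
  qed
  have n2: "1 + complex_of_real (exp y) \<noteq> 0"
  proof -
    have "0 < 1 + exp y" using exp_gt_zero[of y] by linarith
    then show ?thesis by (metis of_real_1 of_real_add of_real_eq_0_iff order_less_irrefl)
  qed
  have d1: "exp (Complex y c) - exp w = - (1 + exp y + z)" by (simp add: e assms(2))
  have d2: "exp (Complex y c) - 1 = - (1 + complex_of_real (exp y))" by (simp add: e)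
  have ne: "exp (Complex y c) \<noteq> exp w" "exp (Complex y c) \<noteq> 1"
    using n1 n2 d1 d2 by (metis neg_equal_0_iff_equal right_minus_eq)+
  have "((\<lambda>n. strip_kernel w (Complex y (h n))) \<longlongrightarrow> strip_kernel w (Complex y c)) F"
    unfolding strip_kernel_def using ne
    by (intro tendsto_intros tendsto_exp tendsto_Complex h) auto
  also have "strip_kernel w (Complex y c) = - complex_of_real (exp y) * z / ((of_real (1 + exp y) + z) * of_real (1 + exp y))"
    unfolding strip_kernel_eq[OF ne] d1 d2 unfolding e assms(2) by (simp, simp add: algebra_simps)
  finally show ?thesis .
qed

subsection \<open>The integral representation\<close>

text \<open>At +infinity the logarithm bound grows like e^(y/2) and the kernel bound decays like
  e^(-y); at -infinity the former stays bounded and the latter decays like e^y. The signs under the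
  absolute values are eventually constant, which removes them before the asymptotics.\<close>

lemma vertical_bound_tendsto_0:
  fixes r p c :: real
  assumes "0 < r" "r < 1" "0 < p"
  defines "B \<equiv> \<lambda>y. (10 * sqrt (1 + exp y) - ln \<bar>1 - r - r * exp y\<bar>) / \<bar>y\<bar>
                  * (exp y * c / (\<bar>exp y - p\<bar> * \<bar>exp y - 1\<bar>))"
  shows "(\<lambda>n. B (real n)) \<longlonglongrightarrow> 0" "(\<lambda>n. B (- real n)) \<longlonglongrightarrow> 0"
proof -
  have 1: "((\<lambda>y. (10 * sqrt (1 + exp y) - ln (r * exp y - (1 - r))) / y
                  * (exp y * c / ((exp y - p) * (exp y - 1)))) \<longlongrightarrow> 0) at_top"
    using assms(1-3) by real_asymp
  have e1: "eventually (\<lambda>y. (10 * sqrt (1 + exp y) - ln (r * exp y - (1 - r))) / y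
                  * (exp y * c / ((exp y - p) * (exp y - 1))) = B y) at_top"
  proof -
    have "eventually (\<lambda>y::real. r * exp y - (1 - r) > 0) at_top" using assms(1-3) by real_asymp
    moreover have "eventually (\<lambda>y::real. exp y - p > 0) at_top" using assms(1-3) by real_asymp
    ultimately show ?thesis using eventually_gt_at_top[of 0]
      by eventually_elim (simp add: B_def abs_if algebra_simps)
  qed
  have 2: "((\<lambda>y. (10 * sqrt (1 + exp (-y)) - ln (1 - r - r * exp (-y))) / y
                  * (exp (-y) * c / ((p - exp (-y)) * (1 - exp (-y))))) \<longlongrightarrow> 0) at_top"
    using assms(1-3) by real_asymp
  have e2: "eventually (\<lambda>y. (10 * sqrt (1 + exp (-y)) - ln (1 - r - r * exp (-y))) / y
                  * (exp (-y) * c / ((p - exp (-y)) * (1 - exp (-y)))) = B (-y)) at_top"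
  proof -
    have "eventually (\<lambda>y::real. 1 - r - r * exp (-y) > 0) at_top" using assms(1-3) by real_asymp
    moreover have "eventually (\<lambda>y::real. p - exp (-y) > 0) at_top" using assms(1-3) by real_asymp
    ultimately show ?thesis using eventually_gt_at_top[of 0]
      by eventually_elim (simp add: B_def abs_if)
  qed
  show "(\<lambda>n. B (real n)) \<longlonglongrightarrow> 0"
    by (rule filterlim_compose[OF Lim_transform_eventually[OF 1 e1] filterlim_real_sequentially])
  show "(\<lambda>n. B (- real n)) \<longlonglongrightarrow> 0"
    by (rule filterlim_compose[OF Lim_transform_eventually[OF 2 e2] filterlim_real_sequentially])
qed

text \<open>The poles w and 0 of the kernel contribute H w = f_r(z) and H 0 = r. The integral is
  left in the variable y in which the boundary limit produces it; t returns in
  \<open>f_r_representation\<close>.\<close>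

lemma f_r_representation_exp:
  assumes r: "0 < r" "r < 1" and z: "z \<in> slit_plane (-1)" "z \<noteq> 0"
  defines "T \<equiv> \<lambda>y. exp y *\<^sub>R (sigma_real r (1 + exp y) *\<^sub>R (z / (z + of_real (1 + exp y))))"
  shows "integrable lborel T" "f_r r z = of_real r + (LINT y|lborel. T y)"
proof -
  define w where "w = Ln (1 + z)"
  have ws: "w \<in> strip" unfolding w_def by (rule Ln_one_plus_in_strip[OF z(1)])
  have ew: "exp w = 1 + z"
    unfolding w_def using slit_plane_one_plus_nonpos[OF z(1)] by (intro exp_Ln) auto
  have w0: "w \<noteq> 0" using ew z(2) by auto
  define H where "H = (\<lambda>v. f_r r (exp v - 1))"
  define g where "g = (\<lambda>v. H v * strip_kernel w v)"
  have H_hol: "H holomorphic_on strip" unfolding H_def by (rule holomorphic_f_r_exp[OF r])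
  have exp_ne: "exp v \<noteq> exp w" "exp v \<noteq> 1" if "v \<in> strip - {w, 0}" for v
    using exp_eq_on_strip[of v w] exp_eq_on_strip[of v 0] that ws by (auto simp: strip_def)
  have g_cont: "continuous_on (strip - {w, 0}) g"
    unfolding g_def strip_kernel_def using exp_ne
    by (intro continuous_intros holomorphic_on_imp_continuous_on[OF holomorphic_on_subset[OF H_hol]]) auto

  \<comment> \<open>Half the distance of w from the boundary of the strip. Since also d <= pi/2, the
    lines at height h n >= pi - d stay at distance at least d from w and 0 and from their translates
    by 2 pi i.\<close>
  define d where "d = (pi - \<bar>Im w\<bar>) / 2"
  have "\<bar>Im w\<bar> < pi" using ws by (simp add: strip_def)
  then have d: "0 < d" "d \<le> pi / 2" "\<bar>Im w\<bar> = pi - 2 * d" by (simp_all add: d_def field_simps)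
  \<comment> \<open>\<open>Suc n\<close> makes h 0 = pi - d, so that every h n is admissible, not
    only the late ones.\<close>
  define h where "h = (\<lambda>n. pi - d / real (Suc n))"
  have h_lt: "h n < pi" for n using d by (simp add: h_def)
  have h_ge: "pi - d \<le> h n" for n
  proof -
    have "d / real (Suc n) \<le> d / 1" using d by (intro divide_left_mono) auto
    then show ?thesis by (simp add: h_def)
  qed
  have h_ge_one: "1 \<le> h n" for n using h_ge[of n] d pi_ge_two by linarith
  have h_lim: "h \<longlonglongrightarrow> pi"
  proof -
    have "(\<lambda>n. pi - d * (1 / real (Suc n))) \<longlonglongrightarrow> pi - d * 0"
      by (intro tendsto_intros LIMSEQ_Suc[OF lim_1_over_n])
    then show ?thesis by (simp add: h_def)
  qed

  define Lb where "Lb = (\<lambda>y. 10 * sqrt (1 + exp y) - ln \<bar>1 - r - r * exp y\<bar>)"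
  define c where "c = norm z / ((1 - cos d) / 2 * min 1 (exp (Re w)))"
  have hor_in: "Complex y t \<in> strip - {w, 0}"
    and hor: "1 - r - r * exp y \<noteq> 0 \<Longrightarrow> norm (g (Complex y t)) \<le> c * (exp y * (Lb y / (1 + exp y)\<^sup>2))"
    if t: "\<bar>t\<bar> = h n" for y t n
  proof -
    let ?v = "Complex y t"
    have vs: "?v \<in> strip" using t h_lt[of n] by (auto simp: strip_def)
    have "d \<le> \<bar>t - Im w\<bar>" "\<bar>t - Im w\<bar> \<le> 2 * pi - d" "d \<le> \<bar>t\<bar>" "\<bar>t\<bar> \<le> 2 * pi - d"
      using t h_lt[of n] h_ge[of n] d by linarith+
    note dist = this
    have v0: "?v \<noteq> w" "?v \<noteq> 0"
      using dist d by (auto simp: complex_eq_iff)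
    then show "?v \<in> strip - {w, 0}" using vs by auto
    assume u: "1 - r - r * exp y \<noteq> 0"
    have K: "norm (strip_kernel w ?v) \<le> c * (exp y / (1 + exp y)\<^sup>2)"
      using norm_strip_kernel_le_horizontal[of d ?v w] d vs v0 ws dist ew pi_gt_zero
      by (simp add: c_def)
    have H: "norm (H ?v) \<le> Lb y"
      using norm_f_r_exp_le[OF r vs v0(2), of 1] u abs_Im_le_cmod[of ?v] t h_ge_one[of n]
      by (simp add: H_def Lb_def)
    have "norm (g ?v) \<le> Lb y * (c * (exp y / (1 + exp y)\<^sup>2))"
      unfolding g_def norm_mult using H order_trans[OF norm_ge_zero H] by (intro mult_mono K) auto
    then show "norm (g ?v) \<le> c * (exp y * (Lb y / (1 + exp y)\<^sup>2))" by (simp add: mult_ac)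
  qed

  define B where "B = (\<lambda>y. Lb y / \<bar>y\<bar> * (exp y * norm z / (\<bar>exp y - exp (Re w)\<bar> * \<bar>exp y - 1\<bar>)))"
  have B_lim: "(\<lambda>n. B (real n)) \<longlonglongrightarrow> 0" "(\<lambda>n. B (- real n)) \<longlonglongrightarrow> 0"
    using vertical_bound_tendsto_0[OF r, of "exp (Re w)" "norm z"] by (simp_all add: B_def Lb_def)
  have ver: "norm (g v) \<le> B (Re v)"
    if "v \<in> strip" "1 - r - r * exp (Re v) \<noteq> 0" "Re v \<noteq> Re w" "Re v \<noteq> 0" for v
  proof -
    have H: "norm (H v) \<le> Lb (Re v) / \<bar>Re v\<bar>"
      unfolding H_def Lb_def
      by (rule norm_f_r_exp_le[OF r that(1) _ that(2)]) (use that(4) abs_Re_le_cmod[of v] in auto)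
    have K: "norm (strip_kernel w v) \<le> exp (Re v) * norm z / (\<bar>exp (Re v) - exp (Re w)\<bar> * \<bar>exp (Re v) - 1\<bar>)"
      using norm_strip_kernel_le_vertical[of v w] that ew by simp
    show ?thesis unfolding g_def norm_mult B_def
      using order_trans[OF norm_ge_zero H] by (intro mult_mono H K) auto
  qed

  define I where "I = (\<lambda>n. integral {- real n..real n} (\<lambda>y. g (Complex y (- h n)) - g (Complex y (h n))))"
  have ev_u: "eventually (\<lambda>n. 1 - r - r * exp (real n) \<noteq> 0 \<and> 1 - r - r * exp (- real n) \<noteq> 0) sequentially"
  proof -
    have "eventually (\<lambda>n. 1 - r - r * exp (real n) < 0) sequentially"
      "eventually (\<lambda>n. 1 - r - r * exp (- real n) > 0) sequentially"
      using r by real_asymp+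
    then show ?thesis by eventually_elim auto
  qed
  have "eventually (\<lambda>n. norm (I n - 2 * pi * \<i> * (H w - H 0))
      \<le> 4 * pi * (\<bar>B (real n)\<bar> + \<bar>B (- real n)\<bar>)) sequentially"
    using ev_u eventually_gt_at_top[of "nat \<lceil>\<bar>Re w\<bar>\<rceil>"]
  proof eventually_elim
    case (elim n)
    then have n: "\<bar>Re w\<bar> < real n" by linarith
    let ?a = "Complex (- real n) (- h n)" and ?b = "Complex (real n) (h n)"
    have Imw: "\<bar>Im w\<bar> < h n" using d h_ge[of n] by linarith
    have inbox: "w \<in> box ?a ?b" "0 \<in> box ?a ?b"
      using n Imw by (auto simp: in_box_complex_iff)
    have sub: "cbox ?a ?b \<subseteq> strip"
    proof
      fix v assume "v \<in> cbox ?a ?b"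
      then have "- h n \<le> Im v" "Im v \<le> h n" by (auto simp: in_cbox_complex_iff)
      then show "v \<in> strip" using h_lt[of n] by (simp add: strip_eq)
    qed
    have "0 \<le> h n" using Imw by linarith
    then have img: "path_image (rectpath ?a ?b) \<subseteq> strip - {w, 0}"
      using path_image_rectpath_subset_cbox[of ?a ?b] path_image_rectpath_inter_box[of ?a ?b]
        inbox sub by auto
    have "(g has_contour_integral (2 * pi * \<i> * H w - 2 * pi * \<i> * H 0)) (rectpath ?a ?b)"
    proof (rule has_contour_integral_eq)
      \<comment> \<open>Written with \<open>exp 0\<close>, the second term is an instance of
        \<open>Cauchy_exp_kernel_rectpath\<close> with the pole at 0.\<close>
      show "((\<lambda>v. H v * exp v / (exp v - exp w) - H v * exp v / (exp v - exp 0))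
          has_contour_integral (2 * pi * \<i> * H w - 2 * pi * \<i> * H 0)) (rectpath ?a ?b)"
        by (intro has_contour_integral_diff Cauchy_exp_kernel_rectpath H_hol inbox sub)
    qed (simp add: g_def strip_kernel_def right_diff_distrib)
    then have "norm (I n - (2 * pi * \<i> * H w - 2 * pi * \<i> * H 0))
        \<le> 4 * h n * (\<bar>B (real n)\<bar> + \<bar>B (- real n)\<bar>)"
      unfolding I_def
    proof (rule rectpath_horizontal_sides_bound)
      show "continuous_on (path_image (rectpath ?a ?b)) g"
        by (rule continuous_on_subset[OF g_cont img])
      fix v assume v: "\<bar>Im v\<bar> \<le> h n" "\<bar>Re v\<bar> = real n"
      then have vs: "v \<in> strip" using h_lt[of n] by (auto simp: strip_def)
      have rv: "Re v = real n \<or> Re v = - real n" using v by linarith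
      have "norm (g v) \<le> B (Re v)"
      proof (rule ver[OF vs])
        show "1 - r - r * exp (Re v) \<noteq> 0" using rv elim(1) by metis
        show "Re v \<noteq> Re w" "Re v \<noteq> 0" using v n by auto
      qed
      also have "B (Re v) \<le> \<bar>B (real n)\<bar> + \<bar>B (- real n)\<bar>"
        using rv by (elim disjE; simp only:; linarith)
      finally show "norm (g v) \<le> \<bar>B (real n)\<bar> + \<bar>B (- real n)\<bar>" .
    qed (use n Imw in linarith)+
    also have "\<dots> \<le> 4 * pi * (\<bar>B (real n)\<bar> + \<bar>B (- real n)\<bar>)"
      using h_lt[of n] by (intro mult_right_mono) auto
    finally show ?case by (simp add: right_diff_distrib)
  qed
  moreover have "(\<lambda>n. 4 * pi * (\<bar>B (real n)\<bar> + \<bar>B (- real n)\<bar>)) \<longlonglongrightarrow> 0"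
    by (intro tendsto_mult_right_zero tendsto_add_zero tendsto_rabs_zero B_lim)
  ultimately have "(\<lambda>n. I n - 2 * pi * \<i> * (H w - H 0)) \<longlonglongrightarrow> 0"
    by (rule Lim_null_comparison)
  then have I_lim: "I \<longlonglongrightarrow> 2 * pi * \<i> * (H w - H 0)"
    by (rule LIM_zero_cancel)

  \<comment> \<open>Extension by zero turns the integrals over [-n, n] into integrals over the line,
    to which dominated convergence applies.\<close>
  define S where "S = (\<lambda>n y. indicator {- real n..real n} y *\<^sub>R (g (Complex y (- h n)) - g (Complex y (h n))))"
  have cont: "continuous_on UNIV (\<lambda>y. g (Complex y (- h n)) - g (Complex y (h n)))" for n
    using h_ge_one[of n]
    by (intro continuous_intros continuous_on_compose2[OF g_cont] continuous_on_Complex image_subsetI hor_in) auto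
  have I_S: "I n = (LINT y|lborel. S n y)" for n
    unfolding I_def S_def
    using set_borel_integral_eq_integral(2)[OF borel_integrable_atLeastAtMost'[OF continuous_on_subset[OF cont subset_UNIV]]]
    by (simp add: set_lebesgue_integral_def)
  have S_meas: "S n \<in> borel_measurable lborel" for n
    unfolding S_def using borel_measurable_continuous_on_indicator[OF _ continuous_on_subset[OF cont subset_UNIV]] by simp
  \<comment> \<open>The excluded y corresponds to t = 1/r.\<close>
  have u_AE: "AE y in lborel. 1 - r - r * exp y \<noteq> 0"
    using AE_lborel_singleton[of "ln ((1 - r) / r)"]
  proof eventually_elim
    fix y assume "y \<noteq> ln ((1 - r) / r)"
    moreover have "y = ln ((1 - r) / r)" if "1 - r - r * exp y = 0"
    proof -
      have "exp y = (1 - r) / r" using that r by (simp add: field_simps)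
      then show ?thesis by (metis ln_exp)
    qed
    ultimately show "1 - r - r * exp y \<noteq> 0" by blast
  qed
  let ?T = "\<lambda>y. 2 * pi * \<i> * T y"
  \<comment> \<open>Independent of n; the factor 2 accounts for the two horizontal sides.\<close>
  let ?D = "\<lambda>y. 2 * (c * (exp y * (Lb y / (1 + exp y)\<^sup>2)))"
  have T_meas: "?T \<in> borel_measurable lborel" unfolding T_def by measurable
  have D_int: "integrable lborel ?D"
  proof -
    have eq: "1 - r * (1 + exp y) = 1 - r - r * exp y" for y by (simp add: algebra_simps)
    have "integrable lborel (\<lambda>y. exp y *\<^sub>R ((10 * sqrt (1 + exp y) - ln \<bar>1 - r * (1 + exp y)\<bar>) / (1 + exp y)\<^sup>2))"
      using set_integrable_log_dominator[OF r] by (subst (asm) set_integrable_one_plus_exp_iff) auto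
    then have "integrable lborel (\<lambda>y. exp y * (Lb y / (1 + exp y)\<^sup>2))"
      unfolding eq by (simp add: Lb_def)
    then show ?thesis by (intro integrable_mult_right)
  qed
  have bound: "AE y in lborel. norm (S n y) \<le> ?D y" for n
    using u_AE
  proof eventually_elim
    fix y assume u: "1 - r - r * exp y \<noteq> 0"
    have *: "norm (g (Complex y (- h n)) - g (Complex y (h n))) \<le> ?D y"
    proof -
      have "\<bar>- h n\<bar> = h n" "\<bar>h n\<bar> = h n" using h_ge_one[of n] by auto
      from add_mono[OF hor[OF this(1) u] hor[OF this(2) u]] show ?thesis
        unfolding mult_2 by (rule order_trans[OF norm_triangle_ineq4])
    qed
    have "norm (S n y) \<le> norm (g (Complex y (- h n)) - g (Complex y (h n)))"
      by (simp add: S_def indicator_def)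
    then show "norm (S n y) \<le> ?D y" using * by (rule order_trans)
  qed
  have lim: "AE y in lborel. (\<lambda>n. S n y) \<longlonglongrightarrow> ?T y"
    using u_AE
  proof eventually_elim
    fix y assume u: "1 - r - r * exp y \<noteq> 0"
    define l where "l = cut_log (1 - r - r * exp y) / Complex y pi"
    let ?K = "- complex_of_real (exp y) * z / ((of_real (1 + exp y) + z) * of_real (1 + exp y))"
    have up: "(\<lambda>n. H (Complex y (h n))) \<longlonglongrightarrow> l"
      unfolding H_def l_def using h_ge_one h_lt
      by (intro f_r_exp_upper_boundary r u h_lim) (auto intro: less_le_trans[OF zero_less_one])
    have "cnj (H (Complex y (h n))) = H (Complex y (- h n))" for n
    proof -
      have "Complex y (h n) \<in> strip" using hor_in[of "h n" n y] h_ge_one[of n] by auto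
      moreover have "exp (Complex y (- h n)) = cnj (exp (Complex y (h n)))"
        by (simp add: exp_cnj complex_eq_iff Re_exp Im_exp)
      ultimately show ?thesis unfolding H_def
        using f_r_cnj[OF r exp_minus_one_in_slit_plane] by simp
    qed
    then have low: "(\<lambda>n. H (Complex y (- h n))) \<longlonglongrightarrow> cnj l"
      using tendsto_cnj[OF up] by simp
    \<comment> \<open>The limits of H on the two lines are conjugate, so the jump retains only Im l,
      which is the density up to explicit factors.\<close>
    have cl: "cnj l - l = - 2 * \<i> * Im l" by (simp add: complex_eq_iff)
    have "(\<lambda>n. g (Complex y (- h n)) - g (Complex y (h n))) \<longlonglongrightarrow> cnj l * ?K - l * ?K"
      unfolding g_def using h_lim
      by (intro tendsto_diff tendsto_mult up low strip_kernel_boundary[OF z(1) ew, where c = pi]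
          strip_kernel_boundary[OF z(1) ew, where c = "- pi"] tendsto_minus) auto
    also have "cnj l * ?K - l * ?K = - 2 * \<i> * Im l * ?K"
      unfolding left_diff_distrib[symmetric] cl ..
    also have "\<dots> = ?T y"
    proof -
      \<comment> \<open>The factor q = 1 + e^y of Im l cancels the one in the denominator of the
        kernel.\<close>
      have cancel: "- 2 * \<i> * (p * q * s) * (- e * z / ((q + z) * q)) = 2 * p * \<i> * (e * (s * (z / (z + q))))"
        if "q \<noteq> 0" for p q s e :: complex
      proof -
        have "q * (e * z / ((q + z) * q)) = e * z / (z + q)" using that by (simp add: add.commute)
        then show ?thesis using that by (simp add: mult_ac)
      qed
      have "1 + exp y \<noteq> 0" using exp_gt_zero[of y] by linarith
      then have "complex_of_real (1 + exp y) \<noteq> 0" unfolding of_real_eq_0_iff .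
      then show ?thesis
        unfolding l_def Im_cut_log_divide[OF r u] T_def scaleR_conv_of_real of_real_mult of_real_numeral
        by (rule cancel)
    qed
    finally have *: "(\<lambda>n. g (Complex y (- h n)) - g (Complex y (h n))) \<longlonglongrightarrow> ?T y" .
    obtain N :: nat where N: "\<bar>y\<bar> \<le> real N" using real_arch_simple by blast
    have "eventually (\<lambda>n. g (Complex y (- h n)) - g (Complex y (h n)) = S n y) sequentially"
      by (intro eventually_sequentiallyI[of N]) (use N in \<open>auto simp: S_def split: split_indicator\<close>)
    with * show "(\<lambda>n. S n y) \<longlonglongrightarrow> ?T y" by (rule Lim_transform_eventually)
  qed
  have T_int: "integrable lborel ?T"
    by (rule integrable_dominated_convergence[OF T_meas S_meas D_int lim bound])
  have "I \<longlonglongrightarrow> (LINT y|lborel. ?T y)"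
    unfolding I_S[abs_def] by (rule integral_dominated_convergence[OF T_meas S_meas D_int lim bound])
  then have eq: "2 * pi * \<i> * (H w - H 0) = (LINT y|lborel. ?T y)"
    using I_lim LIMSEQ_unique by blast
  show T1: "integrable lborel T"
  proof -
    have "integrable lborel (\<lambda>y. 1 / (2 * pi * \<i>) * ?T y)" using T_int by (rule integrable_mult_right)
    then show ?thesis by simp
  qed
  have "2 * pi * \<i> * (H w - H 0) = 2 * pi * \<i> * (LINT y|lborel. T y)"
    unfolding eq by simp
  then have "H w - H 0 = (LINT y|lborel. T y)" by simp
  moreover have "H 0 = of_real r" "H w = f_r r z" by (simp_all add: H_def f_r_def ew)
  ultimately show "f_r r z = of_real r + (LINT y|lborel. T y)" by (simp add: algebra_simps)
qed

text \<open>\<open>sigma_dt\<close> cut down to (1, infinity), as a measure on the whole line. It is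
  the part of \<open>mu_r\<close> away from 0 and turns set integrals over \<open>sigma_dt\<close>
  into plain ones.\<close>

definition nu :: "real \<Rightarrow> real measure" where
  "nu r = density lborel (\<lambda>t. indicator {1<..} t * sigma_r r t)"

lemma sets_nu [measurable_cong, simp]: "sets (nu r) = sets borel"
  and space_nu [simp]: "space (nu r) = UNIV"
  by (simp_all add: nu_def)

text \<open>The two densities differ at most at 1/r, a null set. The real-valued one is what the
  Bochner rules for densities accept.\<close>

lemma nu_eq_sigma_real: "nu r = density lborel (\<lambda>t. ennreal (indicator {1<..} t * sigma_real r t))"
  unfolding nu_def
proof (rule density_cong)
  show "AE t in lborel. indicator {1<..} t * sigma_r r t = ennreal (indicator {1<..} t * sigma_real r t)"
    using AE_lborel_singleton[of "1 / r"]
    by eventually_elim (auto simp: ennreal_sigma_real split: split_indicator)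
qed auto

lemma nu_eq_sigma_dt: "nu r = density (sigma_dt r) (\<lambda>t. ennreal (indicator {1<..} t))"
  unfolding nu_def sigma_dt_def
  by (subst density_density_eq) (auto intro!: density_cong simp: mult.commute ennreal_indicator)

lemma
  fixes f :: "real \<Rightarrow> 'b::{banach, second_countable_topology}"
  assumes [measurable]: "f \<in> borel_measurable borel"
  shows set_integrable_sigma_dt: "set_integrable (sigma_dt r) {1<..} f \<longleftrightarrow> integrable (nu r) f"
    and set_integral_sigma_dt: "(LINT t:{1<..}|sigma_dt r. f t) = integral\<^sup>L (nu r) f"
proof -
  have [measurable_cong]: "sets (sigma_dt r) = sets borel" by (simp add: sigma_dt_def)
  show "set_integrable (sigma_dt r) {1<..} f \<longleftrightarrow> integrable (nu r) f"
    unfolding nu_eq_sigma_dt set_integrable_def by (subst integrable_density) auto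
  show "(LINT t:{1<..}|sigma_dt r. f t) = integral\<^sup>L (nu r) f"
    unfolding nu_eq_sigma_dt set_lebesgue_integral_def by (subst integral_density) auto
qed

lemma AE_nu_gt_one: "AE t in nu r. 1 < t"
  unfolding nu_def by (subst AE_density) (auto split: split_indicator)

theorem f_r_representation:
  assumes r: "0 < r" "r < 1" and z: "z \<in> slit_plane (-1)"
  shows "integrable (nu r) (\<lambda>t. z / (z + of_real t))"
    and "f_r r z = of_real r + (LINT t|nu r. z / (z + of_real t))"
proof -
  have "integrable (nu r) (\<lambda>t. z / (z + of_real t)) \<and> f_r r z = of_real r + (LINT t|nu r. z / (z + of_real t))"
  proof (cases "z = 0")
    case True
    then show ?thesis by (simp add: f_r_def)
  next
    case False
    let ?f = "\<lambda>t. sigma_real r t *\<^sub>R (z / (z + of_real t))"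
    have 1: "integrable (nu r) (\<lambda>t. z / (z + of_real t)) \<longleftrightarrow> set_integrable lborel {1<..} ?f"
      unfolding nu_eq_sigma_real set_integrable_def by (subst integrable_density) auto
    have 2: "(LINT t|nu r. z / (z + of_real t)) = (LINT t:{1<..}|lborel. ?f t)"
      unfolding nu_eq_sigma_real set_lebesgue_integral_def by (subst integral_density) auto
    show ?thesis unfolding 1 2
      using f_r_representation_exp[OF r z False]
      by (simp add: set_integrable_one_plus_exp_iff set_integral_one_plus_exp)
  qed
  then show "integrable (nu r) (\<lambda>t. z / (z + of_real t))"
    and "f_r r z = of_real r + (LINT t|nu r. z / (z + of_real t))" by auto
qed

subsection \<open>Total mass of the representing measure\<close>

definition f_real :: "real \<Rightarrow> real \<Rightarrow> real" where
  "f_real r x = (if x = 0 then r else ln (1 + r * x) / ln (1 + x))"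

lemma of_real_in_slit_plane_iff: "complex_of_real x \<in> slit_plane a \<longleftrightarrow> a < x"
  by (simp add: slit_plane_iff)

lemma f_r_of_real:
  assumes "0 < r" "r < 1" "-1 < x"
  shows "f_r r (of_real x) = of_real (f_real r x)"
proof -
  have pos: "0 < 1 + r * x"
    using mult_strict_left_mono[of "-1" x r] assms by simp
  have 1: "1 + complex_of_real r * of_real x = of_real (1 + r * x)" "1 + complex_of_real x = of_real (1 + x)"
    by simp_all
  show ?thesis
    unfolding f_r_def f_real_def 1 using assms pos by (simp only: Ln_of_real of_real_eq_0_iff) simp
qed

lemma f_real_at_top: "0 < r \<Longrightarrow> r < 1 \<Longrightarrow> (f_real r \<longlongrightarrow> 1) at_top"
proof -
  assume r: "0 < r" "r < 1"
  have "((\<lambda>x. ln (1 + r * x) / ln (1 + x)) \<longlongrightarrow> 1) at_top" using r by real_asymp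
  then show ?thesis
    by (rule Lim_transform_eventually)
       (use eventually_gt_at_top[of 0] in \<open>eventually_elim, simp add: f_real_def\<close>)
qed

lemma f_real_at_right_minus_one: "0 < r \<Longrightarrow> r < 1 \<Longrightarrow> (f_real r \<longlongrightarrow> 0) (at_right (-1))"
proof -
  assume r: "0 < r" "r < 1"
  have "((\<lambda>x. ln (1 + r * x)) \<longlongrightarrow> ln (1 + r * (-1))) (at_right (-1))"
    using r by (intro tendsto_intros) auto
  moreover have "filterlim (\<lambda>x::real. ln (1 + x)) at_bot (at_right (-1))" by real_asymp
  ultimately have "((\<lambda>x. ln (1 + r * x) / ln (1 + x)) \<longlongrightarrow> 0) (at_right (-1))"
    by (intro tendsto_divide_0 filterlim_mono[OF _ at_bot_le_at_infinity order_refl])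
  moreover have "eventually (\<lambda>x. x \<in> {-1<..<0::real}) (at_right (-1))"
    by (rule eventually_at_right_real) simp
  then have "eventually (\<lambda>x. ln (1 + r * x) / ln (1 + x) = f_real r x) (at_right (-1))"
    by eventually_elim (simp add: f_real_def)
  ultimately show ?thesis by (rule Lim_transform_eventually)
qed

lemma f_real_representation:
  assumes r: "0 < r" "r < 1" and x: "-1 < x"
  shows "integrable (nu r) (\<lambda>t. x / (x + t))" "f_real r x = r + (LINT t|nu r. x / (x + t))"
proof -
  have "complex_of_real x \<in> slit_plane (-1)" using x by (simp add: of_real_in_slit_plane_iff)
  note rep = f_r_representation[OF r this]
  have eq: "(\<lambda>t. complex_of_real x / (of_real x + of_real t)) = (\<lambda>t. of_real (x / (x + t)))"
    by simp
  show "integrable (nu r) (\<lambda>t. x / (x + t))"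
    using rep(1) unfolding eq complex_of_real_integrable_eq .
  have "complex_of_real (f_real r x) = of_real (r + (LINT t|nu r. x / (x + t)))"
    using rep(2) unfolding eq f_r_of_real[OF r x] integral_complex_of_real by simp
  then show "f_real r x = r + (LINT t|nu r. x / (x + t))" unfolding of_real_eq_iff .
qed

text \<open>The integrals of n/(n + t) are f_real r n - r, and monotone convergence gives the total
  mass without presupposing that it is finite.\<close>

lemma emeasure_nu:
  assumes r: "0 < r" "r < 1"
  shows "emeasure (nu r) UNIV = ennreal (1 - r)"
proof -
  \<comment> \<open>\<open>max 1 t\<close> equals t almost everywhere for \<open>nu\<close> and
    makes the sequence increasing at every real t.\<close>
  let ?\<phi> = "\<lambda>n t. ennreal (real n / (real n + max 1 t))"
  have "(\<integral>\<^sup>+t. ?\<phi> n t \<partial>nu r) = ennreal (f_real r (real n) - r)" for n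
  proof -
    have "(\<integral>\<^sup>+t. ?\<phi> n t \<partial>nu r) = (\<integral>\<^sup>+t. ennreal (real n / (real n + t)) \<partial>nu r)"
      using AE_nu_gt_one[of r] by (intro nn_integral_cong_AE) (auto elim!: eventually_mono)
    also have "\<dots> = ennreal (LINT t|nu r. real n / (real n + t))"
      using AE_nu_gt_one[of r] f_real_representation(1)[OF r, of "real n"]
      by (intro nn_integral_eq_integral) (auto elim: eventually_mono)
    also have "(LINT t|nu r. real n / (real n + t)) = f_real r (real n) - r"
      using f_real_representation(2)[OF r, of "real n"] by simp
    finally show ?thesis .
  qed
  moreover have "(\<lambda>n. \<integral>\<^sup>+t. ?\<phi> n t \<partial>nu r) \<longlonglongrightarrow> (\<integral>\<^sup>+t. 1 \<partial>nu r)"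
  proof (rule nn_integral_LIMSEQ)
    show "incseq ?\<phi>"
      by (intro incseq_SucI le_funI ennreal_leI) (simp add: divide_simps add_pos_nonneg add_nonneg_pos max_def algebra_simps)
    fix t :: real
    have "(\<lambda>n. real n / (real n + c)) \<longlonglongrightarrow> 1" for c by real_asymp
    then show "(\<lambda>n. ?\<phi> n t) \<longlonglongrightarrow> 1" using tendsto_ennrealI ennreal_1 by metis
  qed auto
  moreover have "(\<lambda>n. ennreal (f_real r (real n) - r)) \<longlonglongrightarrow> ennreal (1 - r)"
    by (intro tendsto_ennrealI tendsto_intros filterlim_compose[OF f_real_at_top[OF r] filterlim_real_sequentially])
  ultimately have "(\<integral>\<^sup>+t. 1 \<partial>nu r) = ennreal (1 - r)"
    using LIMSEQ_unique by simp
  then show ?thesis by simp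
qed

lemma finite_measure_nu: "0 < r \<Longrightarrow> r < 1 \<Longrightarrow> finite_measure (nu r)"
  by (rule finite_measureI) (simp add: emeasure_nu)

lemma measure_nu: "0 < r \<Longrightarrow> r < 1 \<Longrightarrow> measure (nu r) UNIV = 1 - r"
  by (simp add: measure_def emeasure_nu)

lemma slit_plane_add_of_real_neq_0: "z \<in> slit_plane (-1) \<Longrightarrow> 1 < t \<Longrightarrow> z + complex_of_real t \<noteq> 0"
  by (auto simp: slit_plane_iff complex_eq_iff)

text \<open>1 - r is the mass of \<open>nu\<close>, so 1 - f_r(z) is the integral of 1 - z/(z + t) =
  t/(z + t).\<close>

lemma one_minus_f_r_representation:
  assumes r: "0 < r" "r < 1" and z: "z \<in> slit_plane (-1)"
  shows "integrable (nu r) (\<lambda>t. of_real t / (z + of_real t))"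
    and "1 - f_r r z = (LINT t|nu r. of_real t / (z + of_real t))"
proof -
  interpret finite_measure "nu r" by (rule finite_measure_nu[OF r])
  note rep = f_r_representation[OF r z]
  have ae: "AE t in nu r. 1 - z / (z + of_real t) = of_real t / (z + of_real t)"
    using AE_nu_gt_one[of r]
    by eventually_elim (use slit_plane_add_of_real_neq_0[OF z] in \<open>auto simp: field_simps\<close>)
  have int: "integrable (nu r) (\<lambda>t. 1 - z / (z + of_real t))" using rep(1) by simp
  then show "integrable (nu r) (\<lambda>t. of_real t / (z + of_real t))"
    by (subst (asm) integrable_cong_AE[OF _ _ ae]) auto
  have "(LINT t|nu r. of_real t / (z + of_real t)) = (LINT t|nu r. 1 - z / (z + of_real t))"
    by (rule integral_cong_AE[symmetric, OF _ _ ae]) auto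
  also have "\<dots> = of_real (1 - r) - (LINT t|nu r. z / (z + of_real t))"
    using rep(1) measure_nu[OF r] by (simp add: scaleR_conv_of_real)
  finally show "1 - f_r r z = (LINT t|nu r. of_real t / (z + of_real t))"
    using rep(2) by simp
qed

lemma f_r_div_representation:
  assumes r: "0 < r" "r < 1" and z: "z \<in> slit_plane (-1)" "z \<noteq> 0"
  shows "integrable (nu r) (\<lambda>t. 1 / (z + of_real t))"
    and "f_r r z / z = of_real r / z + (LINT t|nu r. 1 / (z + of_real t))"
proof -
  note rep = f_r_representation[OF r z(1)]
  have "integrable (nu r) (\<lambda>t. 1 / z * (z / (z + of_real t)))"
    using rep(1) by (rule integrable_mult_right)
  then show int: "integrable (nu r) (\<lambda>t. 1 / (z + of_real t))" using z by simp
  have "(LINT t|nu r. z * (1 / (z + of_real t))) = z * (LINT t|nu r. 1 / (z + of_real t))"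
    by (rule integral_mult_right_zero)
  then show "f_r r z / z = of_real r / z + (LINT t|nu r. 1 / (z + of_real t))"
    unfolding rep(2) using z by (simp add: add_divide_distrib)
qed

text \<open>\<open>mu_r\<close> lives on [0, infinity) and \<open>nu\<close> on the whole line. Up
  to a null set \<open>mu_r\<close> consists of its atom at 0 and its restriction to (1, infinity),
  which is also the restriction of \<open>nu\<close>; g is split accordingly.\<close>

lemma
  fixes g :: "real \<Rightarrow> 'b::{banach, second_countable_topology}"
  assumes r: "0 < r" and [measurable]: "g \<in> borel_measurable borel" and g: "integrable (nu r) g"
  shows integrable_mu_r: "integrable (mu_r r) g"
    and integral_mu_r: "integral\<^sup>L (mu_r r) g = r *\<^sub>R g 0 + integral\<^sup>L (nu r) g"
proof -
  have sets_iff: "A \<in> sets (mu_r r) \<longleftrightarrow> A \<in> sets borel \<and> A \<subseteq> {0..}" for A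
    by (auto simp: sets_restrict_space_iff)
  have em: "emeasure (mu_r r) A = ennreal r * indicator A 0 + emeasure (nu r) A"
    if "A \<in> sets borel" "A \<subseteq> {0..}" for A
  proof -
    have "A \<in> sets (restrict_space borel {0..})" using that by (auto simp: sets_restrict_space_iff)
    from emeasure_mu_r[OF this, of r] show ?thesis
      using that by (auto simp: nu_def emeasure_density indicator_inter_arith mult_ac intro!: nn_integral_cong)
  qed
  have nu_null: "emeasure (nu r) A = 0" if "A \<in> sets borel" "A \<subseteq> {..1}" for A
  proof -
    have "AE t in nu r. t \<notin> A"
      using AE_nu_gt_one[of r] by (rule AE_mp) (use that in \<open>auto intro!: AE_I2\<close>)
    then show ?thesis using that by (subst (asm) AE_iff_null_sets[symmetric]) (auto simp: null_sets_def)
  qed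
  have meas: "g \<in> borel_measurable (mu_r r)"
    using measurable_cong_sets[OF sets_mu_r refl] measurable_restrict_space1[OF assms(2)] by blast
  have s0: "{0} \<in> sets (mu_r r)" and s1: "{1<..} \<in> sets (mu_r r)" and s2: "{0<..1} \<in> sets (mu_r r)"
    unfolding sets_iff by auto
  have e0: "emeasure (mu_r r) {0} = ennreal r"
    using em[of "{0}"] nu_null[of "{0}"] by simp
  have sub: "{0<..1::real} \<subseteq> {0..}" "{0<..1::real} \<subseteq> {..1}" by auto
  have "emeasure (mu_r r) {0<..1} = 0"
    using em[OF _ sub(1)] nu_null[OF _ sub(2)] by simp
  then have "AE t in mu_r r. t \<notin> {0<..1}"
    using s2 by (intro AE_not_in) (auto simp: null_sets_def)
  then have ae: "AE t in mu_r r. g t = indicator {0} t *\<^sub>R g 0 + indicator {1<..} t *\<^sub>R g t"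
    by (rule AE_mp) (auto intro!: AE_I2 split: split_indicator)
  have sp: "{1<..} \<inter> space (mu_r r) = {1<..}" by auto
  have "restrict_space (mu_r r) {1<..} = restrict_space (nu r) {1<..}"
  proof (rule measure_eqI)
    have "sets (restrict_space (mu_r r) {1<..}) = sets (restrict_space (restrict_space borel {0..}) {1<..})"
      by (rule sets_restrict_space_cong) simp
    also have "\<dots> = sets (restrict_space (nu r) {1<..})"
    proof -
      have "{0..} \<inter> {1<..} = {1::real<..}" by auto
      then show ?thesis by (simp add: restrict_restrict_space sets_restrict_space_cong[of borel "nu r"])
    qed
    finally show *: "sets (restrict_space (mu_r r) {1<..}) = sets (restrict_space (nu r) {1<..})" .
    fix A assume "A \<in> sets (restrict_space (mu_r r) {1<..})"
    then have A: "A \<subseteq> {1<..}" "A \<in> sets borel" unfolding * by (auto simp: sets_restrict_space_iff)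
    have "A \<subseteq> {0..}" using A(1) by (auto intro: order_trans[of 0 1] less_imp_le)
    then show "emeasure (restrict_space (mu_r r) {1<..}) A = emeasure (restrict_space (nu r) {1<..}) A"
      using A em[OF A(2)] sp s1
      by (subst (1 2) emeasure_restrict_space) (auto simp: indicator_def simp del: sets_mu_r)
  qed
  note restr = this
  have int1: "integrable (mu_r r) (\<lambda>t. indicator {1<..} t *\<^sub>R g t) \<longleftrightarrow> integrable (nu r) (\<lambda>t. indicator {1<..} t *\<^sub>R g t)"
    using integrable_restrict_space[of "{1<..}" "mu_r r" g] integrable_restrict_space[of "{1<..}" "nu r" g] s1 restr
    unfolding sp by simp
  have int2: "(LINT t|mu_r r. indicator {1<..} t *\<^sub>R g t) = (LINT t|nu r. indicator {1<..} t *\<^sub>R g t)"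
    using integral_restrict_space[of "{1<..}" "mu_r r" g] integral_restrict_space[of "{1<..}" "nu r" g] s1 restr
    unfolding sp by simp
  have ae_nu: "AE t in nu r. indicator {1<..} t *\<^sub>R g t = g t"
    using AE_nu_gt_one[of r] by eventually_elim simp
  have int3: "integrable (nu r) (\<lambda>t. indicator {1<..} t *\<^sub>R g t)"
    using g by (subst integrable_cong_AE[OF _ _ ae_nu]) auto
  have int4: "(LINT t|nu r. indicator {1<..} t *\<^sub>R g t) = integral\<^sup>L (nu r) g"
    by (rule integral_cong_AE[OF _ _ ae_nu]) auto
  have i0: "integrable (mu_r r) (\<lambda>t. indicator {0} t *\<^sub>R g 0)"
    using s0 e0 by (intro integrable_scaleR_left integrable_real_indicator) auto
  have i0': "(LINT t|mu_r r. indicator {0} t *\<^sub>R g 0) = r *\<^sub>R g 0"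
    using s0 e0 r by (simp add: measure_def)
  have sum_int: "integrable (mu_r r) (\<lambda>t. indicator {0} t *\<^sub>R g 0 + indicator {1<..} t *\<^sub>R g t)"
    using i0 int1 int3 by (intro Bochner_Integration.integrable_add) auto
  note sum_meas = borel_measurable_integrable[OF sum_int]
  show "integrable (mu_r r) g"
    using sum_int by (subst integrable_cong_AE[OF meas sum_meas ae])
  have "integral\<^sup>L (mu_r r) g = (LINT t|mu_r r. indicator {0} t *\<^sub>R g 0 + indicator {1<..} t *\<^sub>R g t)"
    by (rule integral_cong_AE[OF meas sum_meas ae])
  also have "\<dots> = r *\<^sub>R g 0 + integral\<^sup>L (nu r) g"
    using i0 int1 int3 by (subst Bochner_Integration.integral_add) (auto simp: i0' int2 int4)
  finally show "integral\<^sup>L (mu_r r) g = r *\<^sub>R g 0 + integral\<^sup>L (nu r) g" .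
qed

subsection \<open>Laplace transforms and the Bernstein kernel\<close>

text \<open>The inequality x <= e^x at x = ts/n, raised to the n-th power. The bound is constant in
  t, so the moments of a finite measure exist for every s > 0.\<close>

lemma power_mult_exp_le:
  fixes t s :: real
  assumes "0 < t" "0 < s"
  shows "t ^ n * exp (- (t * s)) \<le> (real n / s) ^ n"
proof (cases "n = 0")
  case False
  have "t * s / real n \<le> exp (t * s / real n)"
    using exp_ge_add_one_self[of "t * s / real n"] by linarith
  then have "(t * s / real n) ^ n \<le> exp (t * s / real n) ^ n"
    using assms by (intro power_mono) auto
  also have "\<dots> = exp (t * s)" using False by (simp add: exp_divide_power_eq)
  finally have "t ^ n \<le> (real n / s) ^ n * exp (t * s)"
    using assms False by (simp add: power_divide power_mult_distrib field_simps)
  then show ?thesis by (simp add: exp_minus field_simps)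
qed (use assms in auto)

lemma abs_exp_diff_le:
  fixes a b c :: real
  assumes "a \<le> c" "b \<le> c"
  shows "\<bar>exp a - exp b\<bar> \<le> \<bar>a - b\<bar> * exp c"
proof -
  have *: "exp x - exp y \<le> (x - y) * exp x" for x y :: real
  proof -
    have "(1 + (y - x)) * exp x \<le> exp (y - x) * exp x"
      by (intro mult_right_mono exp_ge_add_one_self) auto
    then show ?thesis by (simp add: exp_diff algebra_simps)
  qed
  have "(x - y) * exp x \<le> \<bar>x - y\<bar> * exp c" if "x \<le> c" for x y
    using that by (intro mult_mono) auto
  from *[of a b] *[of b a] this[of a b] this[of b a] assms show ?thesis
    by (simp add: abs_minus_commute abs_le_iff)
qed

text \<open>What the Laplace transform argument uses of \<open>nu\<close>: a finite Borel measure
  carried by (0, infinity).\<close>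

locale finite_measure_pos = finite_measure M for M :: "real measure" +
  assumes sets_M [measurable_cong, simp]: "sets M = sets borel"
    and AE_pos: "AE t in M. 0 < t"
begin

text \<open>For s > 0, up to sign the n-th derivative of the Laplace transform of M; for M =
  \<open>nu r\<close>, n = 1 gives the function m of (1).\<close>

definition laplace_moment :: "nat \<Rightarrow> real \<Rightarrow> real" where
  "laplace_moment n s = (LINT t|M. t ^ n * exp (- (t * s)))"

lemma laplace_moment_measurable [measurable]: "laplace_moment n \<in> borel_measurable borel"
  unfolding laplace_moment_def by measurable

lemma integrable_laplace_moment:
  assumes "0 < s"
  shows "integrable M (\<lambda>t. t ^ n * exp (- (t * s)))"
proof (rule integrable_const_bound)
  show "AE t in M. norm (t ^ n * exp (- (t * s))) \<le> (real n / s) ^ n"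
    using AE_pos by eventually_elim (use power_mult_exp_le assms in auto)
qed measurable

lemma laplace_moment_nonneg: "0 \<le> laplace_moment n s"
  unfolding laplace_moment_def using AE_pos by (intro integral_nonneg_AE) (auto elim!: eventually_mono)

text \<open>Differentiation under the integral sign, along sequences h -> 0 because dominated
  convergence is sequential. For |h| < s/2 the difference quotients are dominated by the moment
  integrand of order n + 1 at s/2.\<close>

lemma DERIV_laplace_moment:
  assumes s: "0 < s"
  shows "DERIV (laplace_moment n) s :> - laplace_moment (Suc n) s"
  unfolding DERIV_def tendsto_at_iff_sequentially
proof (intro allI impI)
  fix X :: "nat \<Rightarrow> real"
  assume X: "\<forall>i. X i \<in> UNIV - {0}" "X \<longlonglongrightarrow> 0"
  let ?q = "\<lambda>h t. t ^ n * ((exp (- (t * (s + h))) - exp (- (t * s))) / h)"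
  have "eventually (\<lambda>i. dist (X i) 0 < s / 2) sequentially"
    using X(2) s by (intro tendstoD) auto
  then obtain N where N: "\<And>i. N \<le> i \<Longrightarrow> \<bar>X i\<bar> < s / 2"
    by (auto simp: eventually_sequentially dist_real_def)
  \<comment> \<open>Dropping finitely many terms makes |h| < s/2 hold at every index.\<close>
  define Y where "Y = (\<lambda>i. X (i + N))"
  have Y: "Y i \<noteq> 0" "\<bar>Y i\<bar> < s / 2" for i using X(1) N by (auto simp: Y_def)
  have Y_lim: "Y \<longlonglongrightarrow> 0" using X(2) unfolding Y_def by (rule LIMSEQ_ignore_initial_segment)
  have quot: "(laplace_moment n (s + h) - laplace_moment n s) / h = (LINT t|M. ?q h t)"
    if "\<bar>h\<bar> < s / 2" "h \<noteq> 0" for h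
  proof -
    have "(LINT t|M. ?q h t) = (LINT t|M. (t ^ n * exp (- (t * (s + h))) - t ^ n * exp (- (t * s))) / h)"
      by (intro Bochner_Integration.integral_cong) (auto simp: right_diff_distrib)
    also have "\<dots> = (laplace_moment n (s + h) - laplace_moment n s) / h"
      unfolding laplace_moment_def using that s
      by (simp add: Bochner_Integration.integral_diff integrable_laplace_moment)
    finally show ?thesis by (rule sym)
  qed
  have "(\<lambda>i. LINT t|M. ?q (Y i) t) \<longlonglongrightarrow> (LINT t|M. - (t ^ Suc n * exp (- (t * s))))"
  proof (rule integral_dominated_convergence)
    show "integrable M (\<lambda>t. t ^ Suc n * exp (- (t * (s / 2))))"
      using s by (intro integrable_laplace_moment) auto
    show "AE t in M. (\<lambda>i. ?q (Y i) t) \<longlonglongrightarrow> - (t ^ Suc n * exp (- (t * s)))"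
    proof (intro AE_I2)
      fix t
      have "((\<lambda>s. exp (- (t * s))) has_real_derivative - t * exp (- (t * s))) (at s)"
        by (auto intro!: derivative_eq_intros)
      then have "(\<lambda>i. (exp (- (t * (s + Y i))) - exp (- (t * s))) / Y i) \<longlonglongrightarrow> - t * exp (- (t * s))"
        unfolding DERIV_def tendsto_at_iff_sequentially using Y(1) Y_lim by (auto simp: o_def)
      from tendsto_mult[OF tendsto_const[of "t ^ n"] this]
      show "(\<lambda>i. ?q (Y i) t) \<longlonglongrightarrow> - (t ^ Suc n * exp (- (t * s)))" by (simp add: mult_ac)
    qed
    show "AE t in M. norm (?q (Y i) t) \<le> t ^ Suc n * exp (- (t * (s / 2)))" for i
      using AE_pos
    proof eventually_elim
      fix t :: real assume t: "0 < t"
      have "t * (s / 2) \<le> t * (s + Y i)" "t * (s / 2) \<le> t * s"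
        using t s Y(2)[of i] by (auto intro!: mult_left_mono)
      then have "\<bar>exp (- (t * (s + Y i))) - exp (- (t * s))\<bar> \<le> \<bar>- (t * (s + Y i)) - - (t * s)\<bar> * exp (- (t * (s / 2)))"
        by (intro abs_exp_diff_le) auto
      also have "\<bar>- (t * (s + Y i)) - - (t * s)\<bar> = t * \<bar>Y i\<bar>"
        using t by (simp add: algebra_simps abs_mult)
      finally have "\<bar>exp (- (t * (s + Y i))) - exp (- (t * s))\<bar> / \<bar>Y i\<bar> \<le> t * exp (- (t * (s / 2)))"
        using Y(1)[of i] by (simp add: pos_divide_le_eq mult_ac)
      from mult_left_mono[OF this, of "t ^ n"] t
      show "norm (?q (Y i) t) \<le> t ^ Suc n * exp (- (t * (s / 2)))"
        by (simp add: abs_mult mult_ac)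
    qed
  qed measurable
  then have "(\<lambda>i. (laplace_moment n (s + Y i) - laplace_moment n s) / Y i) \<longlonglongrightarrow> - laplace_moment (Suc n) s"
    unfolding quot[OF Y(2,1)] by (simp add: laplace_moment_def)
  then show "((\<lambda>h. (laplace_moment n (s + h) - laplace_moment n s) / h) \<circ> X) \<longlonglongrightarrow> - laplace_moment (Suc n) s"
    unfolding Y_def o_def by (rule LIMSEQ_offset)
qed

text \<open>Formula and differentiability go through the induction together: differentiating the
  formula at s requires it on a neighbourhood, hence the induction over all positive s.\<close>

lemma iterated_deriv_laplace_moment:
  "0 < s \<Longrightarrow> (deriv ^^ k) (laplace_moment n) s = (-1) ^ k * laplace_moment (n + k) s
    \<and> DERIV ((deriv ^^ k) (laplace_moment n)) s :> (-1) ^ Suc k * laplace_moment (n + Suc k) s"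
proof (induction k arbitrary: s)
  case 0
  then show ?case using DERIV_laplace_moment by simp
next
  case (Suc k)
  have eq: "(deriv ^^ Suc k) (laplace_moment n) s = (-1) ^ Suc k * laplace_moment (n + Suc k) s"
    if "0 < s" for s using DERIV_imp_deriv[OF conjunct2[OF Suc.IH[OF that]]] by simp
  have "DERIV (\<lambda>s. (-1) ^ Suc k * laplace_moment (n + Suc k) s) s
      :> (-1) ^ Suc k * - laplace_moment (Suc (n + Suc k)) s"
    by (intro DERIV_cmult DERIV_laplace_moment Suc.prems)
  then have "DERIV ((deriv ^^ Suc k) (laplace_moment n)) s :> (-1) ^ Suc k * - laplace_moment (Suc (n + Suc k)) s"
    by (rule has_field_derivative_transform_within_open[where S = "{0<..}"]) (use Suc.prems eq in auto)
  then show ?case using eq[OF Suc.prems] by simp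
qed

lemma completely_monotonic_laplace_moment: "completely_monotonic (laplace_moment n)"
  unfolding completely_monotonic_def
proof (intro allI impI conjI)
  fix k and s :: real assume s: "0 < s"
  note D = iterated_deriv_laplace_moment[OF s, of k n]
  show "(deriv ^^ k) (laplace_moment n) differentiable at s"
    using D real_differentiable_def by blast
  show "0 \<le> (-1) ^ k * (deriv ^^ k) (laplace_moment n) s"
    using D laplace_moment_nonneg[of "n + k" s] by (simp add: mult.assoc[symmetric] power_add[symmetric])
qed

text \<open>Splitting the integrand into two exponentials gives 1 - t/(x + t).\<close>

lemma nn_integral_exp_kernel:
  fixes x t :: real
  assumes "0 < x" "0 < t"
  shows "(\<integral>\<^sup>+s. ennreal (indicator {0<..} s * ((1 - exp (- (x * s))) * (t * exp (- (t * s))))) \<partial>lborel)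
       = ennreal (x / (x + t))"
proof -
  have "(\<integral>\<^sup>+s. ennreal (indicator {0<..} s * ((1 - exp (- (x * s))) * (t * exp (- (t * s))))) \<partial>lborel)
      = (\<integral>\<^sup>+s. ennreal ((1 - exp (- (x * s))) * (t * exp (- (t * s)))) * indicator {0..} s \<partial>lborel)"
    by (intro nn_integral_cong) (auto split: split_indicator)
  also have "\<dots> = 0 - (- exp (- (t * 0)) + t / (x + t) * exp (- ((x + t) * 0)))"
  proof (rule nn_integral_FTC_atLeast)
    show "DERIV (\<lambda>s. - exp (- (t * s)) + t / (x + t) * exp (- ((x + t) * s))) s
        :> (1 - exp (- (x * s))) * (t * exp (- (t * s)))" for s
    proof -
      have D: "DERIV (\<lambda>s. - exp (- (t * s)) + t / (x + t) * exp (- ((x + t) * s))) s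
          :> t * exp (- (t * s)) - t / (x + t) * ((x + t) * exp (- ((x + t) * s)))"
      proof -
        have E: "DERIV (\<lambda>s. exp (- (c * s))) s :> - c * exp (- (c * s))" for c
          by (auto intro!: derivative_eq_intros)
        show ?thesis
          by (rule DERIV_cong[OF DERIV_add[OF DERIV_minus[OF E] DERIV_cmult[OF E]]])
            (simp only: minus_mult_left mult_minus_right minus_minus diff_conv_add_uminus)
      qed
      have e: "exp (- ((x + t) * s)) = exp (- (x * s)) * exp (- (t * s))"
        by (simp add: exp_add[symmetric] algebra_simps)
      have c: "t / (x + t) * ((x + t) * e) = t * e" for e using assms by simp
      have "t * exp (- (t * s)) - t / (x + t) * ((x + t) * exp (- ((x + t) * s)))
          = (1 - exp (- (x * s))) * (t * exp (- (t * s)))"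
        unfolding c e by (simp add: algebra_simps)
      with D show ?thesis by (rule DERIV_cong)
    qed
    show "((\<lambda>s. - exp (- (t * s)) + t / (x + t) * exp (- ((x + t) * s))) \<longlongrightarrow> 0) at_top"
    proof -
      have E: "((\<lambda>s. exp (- (c * s))) \<longlongrightarrow> 0) at_top" if "0 < c" for c :: real
        using that by real_asymp
      have "((\<lambda>s. - exp (- (t * s)) + t / (x + t) * exp (- ((x + t) * s))) \<longlongrightarrow> - 0 + t / (x + t) * 0) at_top"
        using assms by (intro tendsto_intros E) auto
      then show ?thesis by simp
    qed
  qed (use assms in auto)
  also have "0 - (- exp (- (t * 0)) + t / (x + t) * exp (- ((x + t) * 0))) = x / (x + t)"
    using assms by (simp add: field_simps)
  finally show ?thesis .
qed

text \<open>By Tonelli the s-integral is taken first and evaluated by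
  \<open>nn_integral_exp_kernel\<close>; nonnegativity gives integrability and value
  together.\<close>

lemma laplace_moment_bernstein:
  assumes x: "0 < x" and int: "integrable M (\<lambda>t. x / (x + t))"
  shows "set_integrable lborel {0<..} (\<lambda>s. (1 - exp (- (x * s))) * laplace_moment 1 s)"
    and "(LINT s:{0<..}|lborel. (1 - exp (- (x * s))) * laplace_moment 1 s) = (LINT t|M. x / (x + t))"
proof -
  interpret P: pair_sigma_finite lborel M ..
  let ?k = "\<lambda>s t. indicator {0<..} s * ((1 - exp (- (x * s))) * (t * exp (- (t * s))))"
  let ?m = "\<lambda>s. indicator {0<..} s *\<^sub>R ((1 - exp (- (x * s))) * laplace_moment 1 s)"
  have m_nonneg: "0 \<le> ?m s" for s
    using x laplace_moment_nonneg[of 1 s] by (auto split: split_indicator)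
  have inner: "ennreal (?m s) = (\<integral>\<^sup>+t. ennreal (?k s t) \<partial>M)" for s
  proof (cases "0 < s")
    case True
    have "(\<integral>\<^sup>+t. ennreal (?k s t) \<partial>M) = ennreal (LINT t|M. ?k s t)"
      using integrable_laplace_moment[OF True, of 1] AE_pos True x
      by (intro nn_integral_eq_integral) (auto elim!: eventually_mono)
    then show ?thesis using True by (simp add: laplace_moment_def)
  qed simp
  have "(\<integral>\<^sup>+s. ennreal (?m s) \<partial>lborel) = (\<integral>\<^sup>+t. \<integral>\<^sup>+s. ennreal (?k s t) \<partial>lborel \<partial>M)"
    unfolding inner by (rule P.Fubini'[symmetric]) measurable
  also have "\<dots> = (\<integral>\<^sup>+t. ennreal (x / (x + t)) \<partial>M)"
  proof (rule nn_integral_cong_AE)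
    show "AE t in M. (\<integral>\<^sup>+s. ennreal (?k s t) \<partial>lborel) = ennreal (x / (x + t))"
      using AE_pos by eventually_elim (rule nn_integral_exp_kernel[OF x])
  qed
  also have "\<dots> = ennreal (LINT t|M. x / (x + t))"
    using int AE_pos x by (intro nn_integral_eq_integral) (auto elim!: eventually_mono)
  finally have "has_bochner_integral lborel ?m (LINT t|M. x / (x + t))"
    using m_nonneg AE_pos x
    by (intro has_bochner_integral_nn_integral integral_nonneg_AE) (auto elim!: eventually_mono)
  then show "set_integrable lborel {0<..} (\<lambda>s. (1 - exp (- (x * s))) * laplace_moment 1 s)"
    and "(LINT s:{0<..}|lborel. (1 - exp (- (x * s))) * laplace_moment 1 s) = (LINT t|M. x / (x + t))"
    by (simp_all add: set_integrable_def set_lebesgue_integral_def has_bochner_integral_iff)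
qed

text \<open>Comparison with the case x = 1, since 1 - e^(-s) >= s/(1 + s) >= min(1, s)/2.\<close>

lemma set_integrable_min_laplace_moment:
  assumes int: "integrable M (\<lambda>t. 1 / (1 + t))"
  shows "set_integrable lborel {0<..} (\<lambda>s. min 1 s * laplace_moment 1 s)"
proof -
  have "set_integrable lborel {0<..} (\<lambda>s. 2 * ((1 - exp (- (1 * s))) * laplace_moment 1 s))"
    using laplace_moment_bernstein(1)[OF zero_less_one] int by (intro set_integrable_mult_right) auto
  then show ?thesis
  proof (rule set_integrable_bound)
    have "min 1 s \<le> 2 * (1 - exp (- s))" if "0 < s" for s :: real
    proof -
      have "exp (- s) \<le> 1 / (1 + s)"
        using exp_ge_add_one_self[of s] that by (simp add: exp_minus field_simps)
      moreover have "min 1 s \<le> 2 * (1 - 1 / (1 + s))"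
        using that by (simp add: min_def field_simps)
      ultimately show ?thesis by simp
    qed
    then have "min 1 s * laplace_moment 1 s \<le> 2 * ((1 - exp (- s)) * laplace_moment 1 s)" if "0 < s" for s
      using that laplace_moment_nonneg unfolding mult.assoc[symmetric] by (intro mult_right_mono) auto
    then show "AE s in lborel. s \<in> {0<..} \<longrightarrow>
        norm (min 1 s * laplace_moment 1 s) \<le> norm (2 * ((1 - exp (- (1 * s))) * laplace_moment 1 s))"
      using laplace_moment_nonneg[of 1] by (intro AE_I2) (simp add: abs_mult)
    show "set_borel_measurable lborel {0<..} (\<lambda>s. min 1 s * laplace_moment 1 s)"
      unfolding set_borel_measurable_def by measurable
  qed
qed

end

subsection \<open>Bernstein, Stieltjes and concavity properties\<close>

lemma finite_measure_pos_nu: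
  assumes "0 < r" "r < 1"
  shows "finite_measure_pos (nu r)"
proof -
  interpret finite_measure "nu r" by (rule finite_measure_nu[OF assms])
  show ?thesis by unfold_locales (use AE_nu_gt_one[of r] in \<open>auto elim!: eventually_mono\<close>)
qed

lemma f_real_nonneg:
  assumes r: "0 < r" "r < 1" and x: "0 < x"
  shows "0 \<le> f_real r x"
proof -
  have "0 \<le> (LINT t|nu r. x / (x + t))"
    using AE_nu_gt_one[of r] x by (intro integral_nonneg_AE) (auto elim!: eventually_mono)
  then show ?thesis using f_real_representation(2)[OF r, of x] x r by simp
qed

lemma complete_bernstein_f_real:
  assumes r: "0 < r" "r < 1"
  shows "complete_bernstein (f_real r)"
proof -
  interpret finite_measure_pos "nu r" by (rule finite_measure_pos_nu[OF r])
  have "f_real r x = r + 0 * x + (LINT s:{0<..}|lborel. (1 - exp (- (x * s))) * laplace_moment 1 s)"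
    if "0 < x" for x
    using f_real_representation[OF r, of x] laplace_moment_bernstein(2)[OF that] that by simp
  moreover have "set_integrable lborel {0<..} (\<lambda>s. min 1 s * laplace_moment 1 s)"
    using f_real_representation(1)[OF r, of 1] by (intro set_integrable_min_laplace_moment) simp
  ultimately show ?thesis
    unfolding complete_bernstein_def
    using r f_real_nonneg[OF r] completely_monotonic_laplace_moment[of 1]
    by (intro conjI allI impI exI[of _ r] exI[of _ 0] exI[of _ "laplace_moment 1"]) auto
qed

lemma
  assumes r: "0 < r" "r < 1" and x: "-1 < x"
  shows integrable_one_minus_f_real: "integrable (nu r) (\<lambda>t. t / (x + t))"
    and one_minus_f_real: "1 - f_real r x = (LINT t|nu r. t / (x + t))"
proof -
  have "complex_of_real x \<in> slit_plane (-1)" using x by (simp add: of_real_in_slit_plane_iff)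
  note rep = one_minus_f_r_representation[OF r this]
  have eq: "(\<lambda>t. complex_of_real t / (of_real x + of_real t)) = (\<lambda>t. of_real (t / (x + t)))"
    by simp
  show "integrable (nu r) (\<lambda>t. t / (x + t))"
    using rep(1) unfolding eq complex_of_real_integrable_eq .
  have "complex_of_real (1 - f_real r x) = of_real (LINT t|nu r. t / (x + t))"
    using rep(2) unfolding eq f_r_of_real[OF r x] integral_complex_of_real by simp
  then show "1 - f_real r x = (LINT t|nu r. t / (x + t))" unfolding of_real_eq_iff .
qed

lemma stieltjes_one_minus_f_real:
  assumes r: "0 < r" "r < 1"
  shows "stieltjes (\<lambda>x. 1 - f_real r x)"
proof -
  \<comment> \<open>The measure t dnu(t), on the sigma-algebra over [0, infinity) that
    \<open>stieltjes\<close> prescribes.\<close>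
  define \<mu> where "\<mu> = restrict_space (density (nu r) (\<lambda>t. ennreal t)) {0..}"
  have ae: "AE t in nu r. 0 \<le> t" using AE_nu_gt_one[of r] by (auto elim!: eventually_mono)
  have ae2: "AE t in nu r. t *\<^sub>R (indicator {0..} t *\<^sub>R (1 / (x + t))) = t / (x + t)" for x
    using AE_nu_gt_one[of r] by eventually_elim simp
  have int_eq: "integrable \<mu> (\<lambda>t. 1 / (x + t)) \<longleftrightarrow> integrable (nu r) (\<lambda>t. t / (x + t))" for x
  proof -
    have "integrable \<mu> (\<lambda>t. 1 / (x + t))
        \<longleftrightarrow> integrable (nu r) (\<lambda>t. t *\<^sub>R (indicator {0..} t *\<^sub>R (1 / (x + t))))"
      unfolding \<mu>_def using ae by (subst integrable_restrict_space) (auto simp: integrable_density)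
    also have "\<dots> \<longleftrightarrow> integrable (nu r) (\<lambda>t. t / (x + t))"
      by (rule integrable_cong_AE[OF _ _ ae2]) auto
    finally show ?thesis .
  qed
  have integral_eq: "(LINT t|\<mu>. 1 / (x + t)) = (LINT t|nu r. t / (x + t))" for x
  proof -
    have "(LINT t|\<mu>. 1 / (x + t)) = (LINT t|nu r. t *\<^sub>R (indicator {0..} t *\<^sub>R (1 / (x + t))))"
      unfolding \<mu>_def using ae by (subst integral_restrict_space) (auto simp: integral_density)
    also have "\<dots> = (LINT t|nu r. t / (x + t))"
      by (rule integral_cong_AE[OF _ _ ae2]) auto
    finally show ?thesis .
  qed
  have "0 \<le> 1 - f_real r x" if "0 < x" for x
  proof -
    have "0 \<le> (LINT t|nu r. t / (x + t))"
      using ae that by (intro integral_nonneg_AE) (auto elim!: eventually_mono)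
    then show ?thesis using one_minus_f_real[OF r, of x] that by simp
  qed
  moreover have "sets \<mu> = sets (restrict_space borel {0..})"
    unfolding \<mu>_def by (rule sets_restrict_space_cong) simp
  ultimately show ?thesis
    unfolding stieltjes_def
    using integrable_one_minus_f_real[OF r] one_minus_f_real[OF r]
    by (intro conjI allI impI exI[of _ 0] exI[of _ \<mu>]) (auto simp: int_eq integral_eq)
qed

lemma mu_r_representation:
  assumes r: "0 < r" "r < 1" and z: "z \<in> slit_plane 0"
  shows "integrable (mu_r r) (\<lambda>t. 1 / (z + of_real t))"
    and "f_r r z / z = (LINT t|mu_r r. 1 / (z + of_real t))"
proof -
  have z': "z \<in> slit_plane (-1)" "z \<noteq> 0" using z by (auto simp: slit_plane_iff)
  note rep = f_r_div_representation[OF r z']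
  show "integrable (mu_r r) (\<lambda>t. 1 / (z + of_real t))"
    by (rule integrable_mu_r[OF r(1) _ rep(1)]) measurable
  show "f_r r z / z = (LINT t|mu_r r. 1 / (z + of_real t))"
    unfolding rep(2) by (subst integral_mu_r[OF r(1) _ rep(1)]) (auto simp: scaleR_conv_of_real)
qed

lemma stieltjes_f_real_div:
  assumes r: "0 < r" "r < 1"
  shows "stieltjes (\<lambda>x. f_real r x / x)"
proof -
  have "integrable (mu_r r) (\<lambda>t. 1 / (x + t)) \<and> f_real r x / x = (LINT t|mu_r r. 1 / (x + t))"
    if x: "0 < x" for x
  proof -
    have "complex_of_real x \<in> slit_plane 0" using x by (simp add: of_real_in_slit_plane_iff)
    note rep = mu_r_representation[OF r this]
    have eq: "(\<lambda>t. 1 / (complex_of_real x + of_real t)) = (\<lambda>t. of_real (1 / (x + t)))"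
      by simp
    have fr: "f_r r (of_real x) = of_real (f_real r x)" using x by (intro f_r_of_real[OF r]) auto
    have "complex_of_real (f_real r x / x) = of_real (LINT t|mu_r r. 1 / (x + t))"
      using rep(2) unfolding eq fr integral_complex_of_real by simp
    then show ?thesis
      using rep(1) unfolding eq complex_of_real_integrable_eq of_real_eq_iff by blast
  qed
  then have "\<forall>x>0. integrable (mu_r r) (\<lambda>t. 1 / (x + t)) \<and> f_real r x / x = 0 + (LINT t|mu_r r. 1 / (x + t))"
    by simp
  moreover have "\<forall>x>0. 0 \<le> f_real r x / x" using f_real_nonneg[OF r] by simp
  ultimately show ?thesis
    unfolding stieltjes_def using sets_mu_r[of r] by blast
qed

text \<open>The integrand t/(x + t) of 1 - f_r strictly decreases in x for each t > 1, and
  \<open>nu\<close> has positive mass, so strictness survives integration.\<close>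

lemma strict_mono_on_f_real:
  assumes r: "0 < r" "r < 1"
  shows "strict_mono_on {-1<..} (f_real r)"
proof (rule strict_mono_onI)
  interpret finite_measure "nu r" by (rule finite_measure_nu[OF r])
  fix x y :: real assume xy: "x \<in> {-1<..}" "y \<in> {-1<..}" "x < y"
  have "(LINT t|nu r. t / (y + t)) < (LINT t|nu r. t / (x + t))"
  proof (rule integral_less_AE_space)
    show "AE t in nu r. t / (y + t) < t / (x + t)"
      using AE_nu_gt_one[of r] by eventually_elim (use xy in \<open>auto intro!: divide_strict_left_mono mult_pos_pos\<close>)
  qed (use xy r integrable_one_minus_f_real[OF r] emeasure_nu[OF r] in auto)
  then show "f_real r x < f_real r y"
    using one_minus_f_real[OF r, of x] one_minus_f_real[OF r, of y] xy by simp
qed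

text \<open>Convexity of S keeps the convex combinations, at which f and g are also compared, inside
  S.\<close>

lemma strictly_concave_on_cong:
  assumes "\<And>x. x \<in> S \<Longrightarrow> f x = g x"
  shows "strictly_concave_on S f \<longleftrightarrow> strictly_concave_on S g"
proof (cases "convex S")
  case True
  have "(1 - u) *\<^sub>R x + u *\<^sub>R y \<in> S" if "x \<in> S" "y \<in> S" "x \<noteq> y \<and> 0 < u \<and> u < 1" for x y u
    using convexD_alt[OF True that(1,2), of u] that(3) by simp
  then show ?thesis unfolding strictly_concave_on_def using assms by (metis (no_types, lifting))
qed (simp add: strictly_concave_on_def)

lemma inverse_strictly_convex:
  fixes a b u :: real
  assumes "0 < a" "0 < b" "a \<noteq> b" "0 < u" "u < 1"
  shows "1 / ((1 - u) * a + u * b) < (1 - u) * (1 / a) + u * (1 / b)"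
proof -
  have c: "0 < (1 - u) * a + u * b" using assms by (intro add_pos_pos mult_pos_pos) auto
  have "(1 - u) * (1 / a) + u * (1 / b) - 1 / ((1 - u) * a + u * b)
      = u * (1 - u) * (a - b)\<^sup>2 / (a * b * ((1 - u) * a + u * b))"
    using assms c by (simp add: divide_simps) (simp add: power2_eq_square algebra_simps)
  also have "\<dots> > 0" using assms c by (intro divide_pos_pos mult_pos_pos) auto
  finally show ?thesis by simp
qed

text \<open>For each t > 1 the integrand t/(x + t) of 1 - f_r is strictly convex in x, and positive
  mass again preserves strictness.\<close>

lemma strictly_concave_on_f_real:
  assumes r: "0 < r" "r < 1"
  shows "strictly_concave_on {-1<..} (f_real r)"
  unfolding strictly_concave_on_def
proof (intro conjI ballI allI impI)
  interpret finite_measure "nu r" by (rule finite_measure_nu[OF r])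
  fix x y u :: real
  assume xy: "x \<in> {-1<..}" "y \<in> {-1<..}" and u: "x \<noteq> y \<and> 0 < u \<and> u < 1"
  define v where "v = (1 - u) * x + u * y"
  have "v \<in> {-1<..}"
    using convexD_alt[OF convex_real_interval(3)[of "-1"] xy, of u] u by (simp add: v_def)
  then have v: "-1 < v" by simp
  have int: "integrable (nu r) (\<lambda>t. (1 - u) * (t / (x + t)) + u * (t / (y + t)))"
    using integrable_one_minus_f_real[OF r] xy
    by (intro Bochner_Integration.integrable_add integrable_mult_right) auto
  have "(LINT t|nu r. t / (v + t)) < (LINT t|nu r. (1 - u) * (t / (x + t)) + u * (t / (y + t)))"
  proof (rule integral_less_AE_space[OF integrable_one_minus_f_real[OF r v] int])
    show "AE t in nu r. t / (v + t) < (1 - u) * (t / (x + t)) + u * (t / (y + t))"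
      using AE_nu_gt_one[of r]
    proof eventually_elim
      fix t :: real assume t: "1 < t"
      have "1 / ((1 - u) * (x + t) + u * (y + t)) < (1 - u) * (1 / (x + t)) + u * (1 / (y + t))"
        using t xy u by (intro inverse_strictly_convex) auto
      moreover have "(1 - u) * (x + t) + u * (y + t) = v + t" by (simp add: v_def algebra_simps)
      ultimately have "t * (1 / (v + t)) < t * ((1 - u) * (1 / (x + t)) + u * (1 / (y + t)))"
        using t by (intro mult_strict_left_mono) auto
      then show "t / (v + t) < (1 - u) * (t / (x + t)) + u * (t / (y + t))"
        by (simp add: algebra_simps)
    qed
  qed (use emeasure_nu[OF r] r in auto)
  also have "\<dots> = (1 - u) * (LINT t|nu r. t / (x + t)) + u * (LINT t|nu r. t / (y + t))"
    using integrable_one_minus_f_real[OF r] xy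
    by (subst Bochner_Integration.integral_add) (auto intro!: integrable_mult_right simp del: times_divide_eq_right)
  finally have "1 - f_real r v < (1 - u) * (1 - f_real r x) + u * (1 - f_real r y)"
    using one_minus_f_real[OF r] xy v by simp
  then show "(1 - u) * f_real r x + u * f_real r y < f_real r ((1 - u) *\<^sub>R x + u *\<^sub>R y)"
    by (simp add: v_def algebra_simps)
qed (simp add: convex_real_interval)

section \<open>Endpoint limits of the density and its integral against 1/(1 + t^2)\<close>

lemma sigma_r_at_right_1:
  assumes r: "0 < r" "r < 1"
  shows "(sigma_r r \<longlongrightarrow> 0) (at_right 1)"
proof -
  have "((\<lambda>t. - ln (1 - r * t) / (t * ((ln (t - 1))\<^sup>2 + pi\<^sup>2))) \<longlongrightarrow> 0) (at_right 1)"
  proof -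
    \<comment> \<open>This factor tends to the finite value -ln (1 - r); the limit 0 comes from the
      squared logarithm in the denominator.\<close>
    have "((\<lambda>t. - ln (1 - r * t) / t) \<longlongrightarrow> - ln (1 - r * 1) / 1) (at_right 1)"
      using r by (intro tendsto_intros) auto
    moreover have "filterlim (\<lambda>t::real. (ln (t - 1))\<^sup>2 + pi\<^sup>2) at_top (at_right 1)"
      by real_asymp
    ultimately have "((\<lambda>t. (- ln (1 - r * t) / t) / ((ln (t - 1))\<^sup>2 + pi\<^sup>2)) \<longlongrightarrow> 0) (at_right 1)"
      by (intro tendsto_divide_0 filterlim_mono[OF _ at_top_le_at_infinity order_refl])
    then show ?thesis by (simp add: divide_divide_eq_left)
  qed
  then have "((\<lambda>t. ennreal (- ln (1 - r * t) / (t * ((ln (t - 1))\<^sup>2 + pi\<^sup>2)))) \<longlongrightarrow> ennreal 0) (at_right 1)"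
    by (rule tendsto_ennrealI)
  moreover have "eventually (\<lambda>t. t \<in> {1<..<1 / r}) (at_right 1)"
    by (rule eventually_at_right_real) (use r in simp)
  then have "eventually (\<lambda>t. ennreal (- ln (1 - r * t) / (t * ((ln (t - 1))\<^sup>2 + pi\<^sup>2))) = sigma_r r t) (at_right 1)"
    by eventually_elim (simp add: sigma_r_def)
  ultimately show ?thesis unfolding ennreal_0 by (rule Lim_transform_eventually)
qed

text \<open>The logarithm of the quotient tends to -ln r, so the factor t in the denominator already
  forces the limit 0.\<close>

lemma sigma_r_at_top:
  assumes r: "0 < r" "r < 1"
  shows "(sigma_r r \<longlongrightarrow> 0) at_top"
proof -
  have "((\<lambda>t. ln ((t - 1) / (r * t - 1)) / (t * ((ln (t - 1))\<^sup>2 + pi\<^sup>2))) \<longlongrightarrow> 0) at_top"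
    using r by real_asymp
  then have "((\<lambda>t. ennreal (ln ((t - 1) / (r * t - 1)) / (t * ((ln (t - 1))\<^sup>2 + pi\<^sup>2)))) \<longlongrightarrow> ennreal 0) at_top"
    by (rule tendsto_ennrealI)
  moreover have "eventually (\<lambda>t. ennreal (ln ((t - 1) / (r * t - 1)) / (t * ((ln (t - 1))\<^sup>2 + pi\<^sup>2))) = sigma_r r t) at_top"
    using eventually_gt_at_top[of "1 / r"] by eventually_elim (simp add: sigma_r_def)
  ultimately show ?thesis unfolding ennreal_0 by (rule Lim_transform_eventually)
qed

text \<open>1 + ci has modulus sqrt(1 + c^2) and argument arctan c; c = r gives the numerator and c
  = 1 the denominator of f_r(i).\<close>

lemma Re_f_r_ii:
  assumes r: "0 < r"
  shows "Re (f_r r \<i>) = (ln 2 * ln (1 + r\<^sup>2) + pi * arctan r) / ((ln 2)\<^sup>2 + pi\<^sup>2 / 4)"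
proof -
  have L: "Ln (1 + of_real c * \<i>) = Complex (ln (1 + c\<^sup>2) / 2) (arctan c)" for c :: real
  proof -
    let ?w = "Complex (ln (1 + c\<^sup>2) / 2) (arctan c)"
    have pos: "0 < 1 + c\<^sup>2" by (simp add: add_pos_nonneg)
    have "exp (ln (1 + c\<^sup>2) / 2) = sqrt (1 + c\<^sup>2)"
      using pos by (simp add: ln_sqrt[symmetric])
    then have "exp ?w = 1 + of_real c * \<i>"
      using pos by (simp add: complex_eq_iff Re_exp Im_exp cos_arctan sin_arctan)
    moreover have "Ln (exp ?w) = ?w"
      using arctan_lbound[of c] arctan_ubound[of c] pi_gt_zero by (intro Ln_exp) auto
    ultimately show ?thesis by simp
  qed
  have cancel4: "(a / 4) / (b / 4) = a / b" for a b :: real by simp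
  have "f_r r \<i> = Complex (ln (1 + r\<^sup>2) / 2) (arctan r) / Complex (ln 2 / 2) (pi / 4)"
    using L[of r] L[of 1] by (simp add: f_r_def arctan_one)
  then have "Re (f_r r \<i>) = (ln (1 + r\<^sup>2) / 2 * (ln 2 / 2) + arctan r * (pi / 4)) / ((ln 2 / 2)\<^sup>2 + (pi / 4)\<^sup>2)"
    by (simp add: Re_divide)
  also have "\<dots> = ((ln 2 * ln (1 + r\<^sup>2) + pi * arctan r) / 4) / (((ln 2)\<^sup>2 + pi\<^sup>2 / 4) / 4)"
    by (simp add: power_divide add_divide_distrib mult_ac)
  also have "\<dots> = (ln 2 * ln (1 + r\<^sup>2) + pi * arctan r) / ((ln 2)\<^sup>2 + pi\<^sup>2 / 4)"
    by (rule cancel4)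
  finally show ?thesis .
qed

text \<open>The integrand is the real part of z/(z + t) at z = i.\<close>

lemma
  assumes r: "0 < r" "r < 1"
  shows integrable_nu_inverse_one_plus_square: "integrable (nu r) (\<lambda>t. 1 / (1 + t\<^sup>2))"
    and integral_nu_inverse_one_plus_square: "(LINT t|nu r. 1 / (1 + t\<^sup>2)) = Re (f_r r \<i>) - r"
proof -
  have i: "\<i> \<in> slit_plane (-1)" by (simp add: slit_plane_iff)
  note rep = f_r_representation[OF r i]
  have eq: "Re (\<i> / (\<i> + of_real t)) = 1 / (1 + t\<^sup>2)" for t
    by (simp add: Re_divide add.commute)
  show "integrable (nu r) (\<lambda>t. 1 / (1 + t\<^sup>2))"
    using integrable_Re[OF rep(1)] unfolding eq .
  show "(LINT t|nu r. 1 / (1 + t\<^sup>2)) = Re (f_r r \<i>) - r"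
    using integral_Re[OF rep(1)] rep(2) unfolding eq by simp
qed

theorem theorem2:
  fixes r :: real
  assumes "0 < r" and "r < 1"
  shows
    "(complete_bernstein_on (slit_plane (-1)) (f_r r) \<and>
      (\<forall>z\<in>slit_plane (-1).
         set_integrable (sigma_dt r) {1<..} (\<lambda>t. z / (z + complex_of_real t)) \<and>
         f_r r z = complex_of_real r + (LINT t:{1<..}|sigma_dt r. z / (z + complex_of_real t)))) \<and>
     ((\<forall>x>-1. f_r r (complex_of_real x) \<in> \<real>) \<and>
      strictly_concave_on {-1<..} (\<lambda>x. Re (f_r r (complex_of_real x))) \<and>
      strict_mono_on {-1<..} (\<lambda>x. Re (f_r r (complex_of_real x))) \<and>
      ((\<lambda>x. Re (f_r r (complex_of_real x))) \<longlongrightarrow> 0) (at_right (-1)) \<and>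
      ((\<lambda>x. Re (f_r r (complex_of_real x))) \<longlongrightarrow> 1) at_top) \<and>
     (stieltjes_on (slit_plane (-1)) (\<lambda>z. 1 - f_r r z) \<and>
      (\<forall>z\<in>slit_plane (-1).
         set_integrable (sigma_dt r) {1<..} (\<lambda>t. complex_of_real t / (z + complex_of_real t)) \<and>
         1 - f_r r z =
           (LINT t:{1<..}|sigma_dt r. complex_of_real t / (z + complex_of_real t)))) \<and>
     (stieltjes_on (slit_plane 0) (\<lambda>z. f_r r z / z) \<and>
      (\<forall>z\<in>slit_plane 0.
         integrable (mu_r r) (\<lambda>t. 1 / (z + complex_of_real t)) \<and>
         f_r r z / z = (LINT t|mu_r r. 1 / (z + complex_of_real t)))) \<and>
     ((sigma_r r \<longlongrightarrow> 0) (at_right 1) \<and> (sigma_r r \<longlongrightarrow> 0) at_top) \<and>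
     (set_integrable (sigma_dt r) {1<..} (\<lambda>t. 1 :: real) \<and>
      (LINT t:{1<..}|sigma_dt r. (1 :: real)) = 1 - r \<and>
      set_integrable (sigma_dt r) {1<..} (\<lambda>t. 1 / (1 + t\<^sup>2)) \<and>
      (LINT t:{1<..}|sigma_dt r. 1 / (1 + t\<^sup>2)) =
        (ln 2 * ln (1 + r\<^sup>2) + pi * arctan r) / ((ln 2)\<^sup>2 + pi\<^sup>2 / 4) - r)"
proof -
  note r = assms
  interpret finite_measure "nu r" by (rule finite_measure_nu[OF r])
  have Re_eq: "Re (f_r r (complex_of_real x)) = f_real r x" if "x \<in> {-1<..}" for x
    using that f_r_of_real[OF r] by simp
  have hol: "f_r r holomorphic_on slit_plane (-1)" by (rule holomorphic_f_r[OF r])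

  have "complete_bernstein_on (slit_plane (-1)) (f_r r)"
    unfolding complete_bernstein_on_def
    using hol complete_bernstein_f_real[OF r] f_r_of_real[OF r]
    by (auto simp: of_real_in_slit_plane_iff intro!: exI[of _ "f_real r"])
  then have 1: "complete_bernstein_on (slit_plane (-1)) (f_r r) \<and>
      (\<forall>z\<in>slit_plane (-1).
         set_integrable (sigma_dt r) {1<..} (\<lambda>t. z / (z + complex_of_real t)) \<and>
         f_r r z = complex_of_real r + (LINT t:{1<..}|sigma_dt r. z / (z + complex_of_real t)))"
    using f_r_representation[OF r] by (simp add: set_integrable_sigma_dt set_integral_sigma_dt)

  have "strictly_concave_on {-1<..} (\<lambda>x. Re (f_r r (complex_of_real x)))"
    using strictly_concave_on_f_real[OF r] strictly_concave_on_cong[of "{-1<..}" "\<lambda>x. Re (f_r r (of_real x))" "f_real r"] Re_eq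
    by blast
  moreover have "strict_mono_on {-1<..} (\<lambda>x. Re (f_r r (complex_of_real x)))"
    using strict_mono_on_f_real[OF r] Re_eq by (auto simp: strict_mono_on_def)
  moreover have "((\<lambda>x. Re (f_r r (complex_of_real x))) \<longlongrightarrow> 0) (at_right (-1))"
    using f_real_at_right_minus_one[OF r]
    by (rule Lim_transform_eventually) (auto simp: eventually_at_filter Re_eq)
  moreover have "((\<lambda>x. Re (f_r r (complex_of_real x))) \<longlongrightarrow> 1) at_top"
    using f_real_at_top[OF r]
    by (rule Lim_transform_eventually)
       (use eventually_gt_at_top[of "-1"] in \<open>eventually_elim, simp add: Re_eq\<close>)
  moreover have "\<forall>x>-1. f_r r (complex_of_real x) \<in> \<real>" using f_r_of_real[OF r] by simp
  ultimately have 2: "(\<forall>x>-1. f_r r (complex_of_real x) \<in> \<real>) \<and>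
      strictly_concave_on {-1<..} (\<lambda>x. Re (f_r r (complex_of_real x))) \<and>
      strict_mono_on {-1<..} (\<lambda>x. Re (f_r r (complex_of_real x))) \<and>
      ((\<lambda>x. Re (f_r r (complex_of_real x))) \<longlongrightarrow> 0) (at_right (-1)) \<and>
      ((\<lambda>x. Re (f_r r (complex_of_real x))) \<longlongrightarrow> 1) at_top" by blast

  have "stieltjes_on (slit_plane (-1)) (\<lambda>z. 1 - f_r r z)"
    unfolding stieltjes_on_def
    using hol stieltjes_one_minus_f_real[OF r] f_r_of_real[OF r]
    by (auto simp: of_real_in_slit_plane_iff intro!: exI[of _ "\<lambda>x. 1 - f_real r x"] holomorphic_intros)
  then have 3: "stieltjes_on (slit_plane (-1)) (\<lambda>z. 1 - f_r r z) \<and>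
      (\<forall>z\<in>slit_plane (-1).
         set_integrable (sigma_dt r) {1<..} (\<lambda>t. complex_of_real t / (z + complex_of_real t)) \<and>
         1 - f_r r z =
           (LINT t:{1<..}|sigma_dt r. complex_of_real t / (z + complex_of_real t)))"
    using one_minus_f_r_representation[OF r] by (simp add: set_integrable_sigma_dt set_integral_sigma_dt)

  have "slit_plane 0 \<subseteq> slit_plane (-1)" "0 \<notin> slit_plane 0" by (auto simp: slit_plane_iff)
  then have "(\<lambda>z. f_r r z / z) holomorphic_on slit_plane 0"
    by (intro holomorphic_intros holomorphic_on_subset[OF hol]) auto
  then have "stieltjes_on (slit_plane 0) (\<lambda>z. f_r r z / z)"
    unfolding stieltjes_on_def
    using stieltjes_f_real_div[OF r] f_r_of_real[OF r]
    by (auto simp: of_real_in_slit_plane_iff intro!: exI[of _ "\<lambda>x. f_real r x / x"])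
  then have 4: "stieltjes_on (slit_plane 0) (\<lambda>z. f_r r z / z) \<and>
      (\<forall>z\<in>slit_plane 0.
         integrable (mu_r r) (\<lambda>t. 1 / (z + complex_of_real t)) \<and>
         f_r r z / z = (LINT t|mu_r r. 1 / (z + complex_of_real t)))"
    using mu_r_representation[OF r] by blast

  have 6: "set_integrable (sigma_dt r) {1<..} (\<lambda>t. 1 :: real) \<and>
      (LINT t:{1<..}|sigma_dt r. (1 :: real)) = 1 - r \<and>
      set_integrable (sigma_dt r) {1<..} (\<lambda>t. 1 / (1 + t\<^sup>2)) \<and>
      (LINT t:{1<..}|sigma_dt r. 1 / (1 + t\<^sup>2)) =
        (ln 2 * ln (1 + r\<^sup>2) + pi * arctan r) / ((ln 2)\<^sup>2 + pi\<^sup>2 / 4) - r"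
    using integrable_nu_inverse_one_plus_square[OF r] integral_nu_inverse_one_plus_square[OF r]
      Re_f_r_ii[OF r(1)] measure_nu[OF r]
    by (simp add: set_integrable_sigma_dt set_integral_sigma_dt)

  show ?thesis
    using 1 2 3 4 sigma_r_at_right_1[OF r] sigma_r_at_top[OF r] 6 by blast
qed

end
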